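(* Let $n\ge 2$ and $K,M\in\mathcal{K}^n$. Then $$V(K,M[n-1])\le \frac{1}{n}\,V_1(K)\,V_{n-1}(M).$$ If $\dim(K)\ge 1$ and $\dim(M)\ge n-1$, then equality holds if and only if $K$ is a segment and $M$ is contained in a hyperplane orthogonal to $K$.
   Context: $\mathcal{K}^n$ denotes the set of nonempty compact convex subsets of $\mathbb{R}^n$. For $K,M\in\mathcal{K}^n$ the mixed volumes $V(K[i],M[n-i])$ are the coefficients in the polynomial expansion $V(\alpha K+\beta M)=\sum_{i=0}^n\binom{n}{i}V(K[i],M[n-i])\alpha^i\beta^{n-i}$ for $\alpha,\beta\ge0$, where $V$ is volume; $V(K,M[n-1])$ denotes the case $i=1$. The intrinsic volumes are $V_i(K)=\frac{1}{\kappa_{n-i}}\binom{n}{i}V(K[i],B^n[n-i])$, where $B^n$ is the Euclidean unit ball and $\kappa_m$ is the volume of the unit ball in $\mathbb{R}^m$. In particular $2V_{n-1}(M)$ is the surface area of $M$ and $V_1(K)$ is proportional to the mean width of $K$. *)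

theory Defs
  imports "HOL-Analysis.Analysis"
begin

definition convex_body :: "'a::euclidean_space set \<Rightarrow> bool" where
  "convex_body K \<longleftrightarrow> K \<noteq> {} \<and> compact K \<and> convex K"

text \<open>Mixed volume V(K[i],M[n-i]), n = DIM('a): the coefficients of the polynomial
  expansion V(aK+bM) = sum_i (n choose i) V(K[i],M[n-i]) a^i b^(n-i), a,b >= 0.\<close>
definition mixed_vol :: "'a::euclidean_space set \<Rightarrow> 'a set \<Rightarrow> nat \<Rightarrow> real" where
  "mixed_vol K M i =
     (SOME c :: nat \<Rightarrow> real. \<forall>\<alpha> \<beta>. \<alpha> \<ge> 0 \<longrightarrow> \<beta> \<ge> 0 \<longrightarrow>
        measure lebesgue {\<alpha> *\<^sub>R x + \<beta> *\<^sub>R y | x y. x \<in> K \<and> y \<in> M} =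
        (\<Sum>j\<le>DIM('a). real (DIM('a) choose j) * c j * \<alpha> ^ j * \<beta> ^ (DIM('a) - j))) i"

definition intrinsic_vol :: "'a::euclidean_space set \<Rightarrow> nat \<Rightarrow> real" where
  "intrinsic_vol K i =
     real (DIM('a) choose i) / unit_ball_vol (real (DIM('a) - i)) * mixed_vol K (cball 0 1) i"

end

theory Submission
  imports Defs
begin

text \<open>Polynomiality of the volume of \<open>M + t K\<close>: for polytopes \<open>K = conv W\<close>, \<open>M = conv V\<close> the gradient
  of a combination of log-sum-exp functions and \<open>sqrt (1 + |x|\<^sup>2)\<close> maps the whole space diffeomorphically
  onto \<open>M + t K + ball 0 d\<close>, and its Jacobian determinant is a polynomial in \<open>t\<close>; the resulting
  interpolation identity passes to limits.

  The inequality: let \<open>D(K, M) = n V(K, M[n-1])\<close>, let \<open>B\<close> be the unit ball, \<open>\<kappa>\<close> the volume of the unit ball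
  of dimension \<open>n - 1\<close>, and \<open>R\<close> the circumradius of \<open>K\<close>. Monotonicity gives \<open>D(K, M) \<le> R D(B, M)\<close>.
  Conversely, writing the circumcentre as a convex combination of contact points yields a zonotope
  contained in the difference body \<open>K - K\<close>, whence \<open>2 R \<kappa> \<le> D(K, B)\<close>. Equality in the second bound
  forces antipodal contact points and then, by strict monotonicity of \<open>D(\<cdot>, B)\<close>, makes \<open>K\<close> a segment;
  equality in the first one for a segment of direction \<open>e\<close> forces \<open>D([0, u], M) = 0\<close> for all \<open>u\<close>
  orthogonal to \<open>e\<close>.\<close>

subsection \<open>Sums of polytopes\<close>

text \<open>\<open>mixed_vol\<close> picks its coefficients by \<open>SOME\<close>, so nothing can
  be said about it before an expansion is known to exist; hence the analytic first half. The summand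
  \<open>ball 0 d\<close> makes the Jacobian positive definite even when both polytopes are flat,
  and growth of the potential makes the map onto. Polynomiality is phrased as interpolation at the
  nodes 0, ..., n because an identity between finitely many volumes survives limits of bodies.

  Only first-order coefficients are needed. With V_1(K) = D(K, B) / \<kappa> and V_{n-1}(M) = D(B,
  M) / 2 the claim reads 2 \<kappa> D(K, M) \<le> D(K, B) D(B, M), and it splits as 2 \<kappa> D(K,
  M) \<le> 2 \<kappa> R D(B, M) \<le> D(K, B) D(B, M). The link is D([0, u], B) = \<kappa> |u|,
  which measures segments and, by additivity in the first argument, zonotopes. Passing to K - K
  doubles D(K, B) and makes room for a zonotope of total length 4 R although K need not be
  symmetric.\<close>

lemma det_linear_pencil_poly:
  fixes A B :: "real^'n^'n"
  obtains p :: "real poly" where "degree p \<le> CARD('n)" "\<And>t. det (A + t *\<^sub>R B) = poly p t"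
proof
  define f where "f = (\<lambda>\<pi>. smult (of_int (sign \<pi>)) (\<Prod>i\<in>UNIV. [:A $ i $ \<pi> i, B $ i $ \<pi> i:]))"
  have "degree (f \<pi>) \<le> CARD('n)" for \<pi>
  proof -
    have "degree (f \<pi>) \<le> degree (\<Prod>i\<in>UNIV. [:A $ i $ \<pi> i, B $ i $ \<pi> i:])"
      unfolding f_def by (rule degree_smult_le)
    also have "\<dots> \<le> sum (degree \<circ> (\<lambda>i. [:A $ i $ \<pi> i, B $ i $ \<pi> i:])) UNIV"
      by (rule degree_prod_sum_le) simp
    also have "\<dots> \<le> (\<Sum>i\<in>(UNIV :: 'n set). 1)"
      by (intro sum_mono) simp
    finally show ?thesis by simp
  qed
  then show "degree (\<Sum>\<pi> | \<pi> permutes UNIV. f \<pi>) \<le> CARD('n)"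
    by (intro degree_sum_le) auto
  show "det (A + t *\<^sub>R B) = poly (\<Sum>\<pi> | \<pi> permutes UNIV. f \<pi>) t" for t
    unfolding det_def f_def by (simp add: poly_sum poly_prod mult.commute)
qed

text \<open>The segment from the identity to \<open>f\<close> consists of positive definite maps, so
  the determinant, which starts at 1, never vanishes along it.\<close>

lemma det_pos_of_pos_def:
  fixes f :: "real^'n \<Rightarrow> real^'n"
  assumes lin: "linear f" and pos: "\<And>h. h \<noteq> 0 \<Longrightarrow> f h \<bullet> h > 0"
  shows "det (matrix f) > 0"
proof (rule ccontr)
  assume neg: "\<not> ?thesis"
  define g where "g = (\<lambda>s. det ((1 - s) *\<^sub>R mat 1 + s *\<^sub>R matrix f))"
  have "continuous_on {0..1::real} g"
    unfolding g_def det_def by (auto intro!: continuous_intros)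
  moreover have "g 1 \<le> 0" "g 0 \<ge> 0"
    using neg by (auto simp: g_def)
  ultimately obtain s where s: "0 \<le> s" "s \<le> 1" "g s = 0"
    using IVT2'[of g 1 0 0] by auto
  then obtain h where h: "h \<noteq> 0" "((1 - s) *\<^sub>R mat 1 + s *\<^sub>R matrix f) *v h = 0"
    unfolding g_def using invertible_det_nz matrix_left_invertible_ker
    by (metis invertible_left_inverse)
  then have "(1 - s) *\<^sub>R h + s *\<^sub>R f h = 0"
    using lin by (simp add: matrix_vector_mult_add_rdistrib scaleR_matrix_vector_assoc[symmetric])
  then have "(1 - s) * (h \<bullet> h) + s * (f h \<bullet> h) = 0"
    by (metis inner_add_left inner_scaleR_left inner_zero_left)
  moreover have "f h \<bullet> h > 0" "h \<bullet> h > 0"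
    using h pos by auto
  ultimately show False
    using s by (smt (verit) mult_nonneg_nonneg mult_pos_pos)
qed

text \<open>With fixed nodes 0, ..., \<open>n\<close> the weights do not depend on the bodies, so
  being a polynomial of degree at most \<open>n\<close> becomes one equation between
  volumes.\<close>

definition lagrange_basis :: "nat \<Rightarrow> nat \<Rightarrow> real poly" where
  "lagrange_basis n j = (\<Prod>k\<in>{..n} - {j}. smult (1 / (real j - real k)) [:- real k, 1:])"

lemma poly_lagrange_basis:
  assumes "i \<le> n" "j \<le> n"
  shows "poly (lagrange_basis n j) (real i) = (if i = j then 1 else 0)"
  using assms unfolding lagrange_basis_def poly_prod
  by (auto intro!: prod.neutral simp: diff_divide_distrib[symmetric])

lemma degree_lagrange_basis:
  assumes "j \<le> n"
  shows "degree (lagrange_basis n j) \<le> n"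
proof -
  have "degree (lagrange_basis n j)
      \<le> sum (degree \<circ> (\<lambda>k. smult (1 / (real j - real k)) [:- real k, 1:])) ({..n} - {j})"
    unfolding lagrange_basis_def by (rule degree_prod_sum_le) simp
  also have "\<dots> \<le> (\<Sum>k\<in>{..n} - {j}. 1)"
    by (intro sum_mono) simp
  finally show ?thesis
    using assms by simp
qed

lemma lagrange_interpolation:
  assumes "degree p \<le> n"
  shows "p = (\<Sum>j\<le>n. smult (poly p (real j)) (lagrange_basis n j))"
proof (rule poly_eqI_degree[where A = "real ` {..n}"])
  show "poly p x = poly (\<Sum>j\<le>n. smult (poly p (real j)) (lagrange_basis n j)) x"
    if "x \<in> real ` {..n}" for x
    using that by (auto simp: poly_sum poly_lagrange_basis if_distrib sum.delta' cong: if_cong)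
  have "degree (\<Sum>j\<le>n. smult (poly p (real j)) (lagrange_basis n j)) \<le> n"
    by (intro degree_sum_le) (auto intro: order_trans[OF degree_smult_le] degree_lagrange_basis)
  then show "card (real ` {..n}) > degree p"
    "card (real ` {..n}) > degree (\<Sum>j\<le>n. smult (poly p (real j)) (lagrange_basis n j))"
    using assms by (simp_all add: card_image)
qed

text \<open>Smooth convex majorant of the support function of \<open>convex hull V\<close>;
  \<open>softmax_mean V\<close> is its gradient and \<open>softmax_cov V x\<close> its Hessian at
  \<open>x\<close>.\<close>

definition log_sum_exp :: "'a::euclidean_space set \<Rightarrow> 'a \<Rightarrow> real" where
  "log_sum_exp V x = ln (\<Sum>v\<in>V. exp (v \<bullet> x))"

definition softmax_mean :: "'a::euclidean_space set \<Rightarrow> 'a \<Rightarrow> 'a" where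
  "softmax_mean V x = (\<Sum>v\<in>V. exp (v \<bullet> x) *\<^sub>R v) /\<^sub>R (\<Sum>v\<in>V. exp (v \<bullet> x))"

text \<open>With the weights exp (v . x) normalised to a probability on \<open>V\<close>, this is
  the covariance operator applied to \<open>h\<close>.\<close>

definition softmax_cov :: "'a::euclidean_space set \<Rightarrow> 'a \<Rightarrow> 'a \<Rightarrow> 'a" where
  "softmax_cov V x h = (\<Sum>v\<in>V. (exp (v \<bullet> x) * (v \<bullet> h)) *\<^sub>R v) /\<^sub>R (\<Sum>v\<in>V. exp (v \<bullet> x))
     - (softmax_mean V x \<bullet> h) *\<^sub>R softmax_mean V x"

context
  fixes V :: "'a::euclidean_space set"
  assumes fin: "finite V" and ne: "V \<noteq> {}"
begin

lemma sum_exp_pos: "(\<Sum>v\<in>V. exp (v \<bullet> x)) > 0"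
  using fin ne by (intro sum_pos) auto

lemma log_sum_exp_has_derivative:
  "(log_sum_exp V has_derivative (\<lambda>h. softmax_mean V x \<bullet> h)) (at x)"
  unfolding log_sum_exp_def [abs_def] softmax_mean_def
  using sum_exp_pos[of x]
  by (auto intro!: derivative_eq_intros ext
      simp: inner_sum_left sum_distrib_left divide_inverse mult_ac)

lemma softmax_mean_has_derivative:
  "(softmax_mean V has_derivative softmax_cov V x) (at x)"
proof -
  let ?S = "\<lambda>x. \<Sum>v\<in>V. exp (v \<bullet> x)"
  let ?G = "\<lambda>x. \<Sum>v\<in>V. exp (v \<bullet> x) *\<^sub>R v"
  have S: "(?S has_derivative (\<lambda>h. ?G x \<bullet> h)) (at x)"
    by (auto intro!: derivative_eq_intros simp: inner_sum_left mult_ac)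
  have G: "(?G has_derivative (\<lambda>h. \<Sum>v\<in>V. (exp (v \<bullet> x) * (v \<bullet> h)) *\<^sub>R v)) (at x)"
    by (auto intro!: derivative_eq_intros simp: mult_ac)
  have "((\<lambda>x. inverse (?S x)) has_derivative (\<lambda>h. - (inverse (?S x) * (?G x \<bullet> h) * inverse (?S x)))) (at x)"
    using sum_exp_pos[of x] by (intro Deriv.has_derivative_inverse[OF _ S]) auto
  from has_derivative_scaleR[OF this G]
  show ?thesis
    unfolding softmax_mean_def [abs_def]
    by (rule has_derivative_eq_rhs)
      (auto simp: softmax_cov_def softmax_mean_def fun_eq_iff algebra_simps)
qed

text \<open>The quadratic form is the variance of \<open>v \<bullet> h\<close> under the normalised
  weights. It may vanish, for instance when \<open>V\<close> is flat.\<close>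

lemma softmax_cov_nonneg: "softmax_cov V x h \<bullet> h \<ge> 0"
proof -
  let ?S = "\<Sum>v\<in>V. exp (v \<bullet> x)" and ?m = "softmax_mean V x"
  have Sm: "?S * (?m \<bullet> h) = (\<Sum>v\<in>V. exp (v \<bullet> x) * (v \<bullet> h))"
    using sum_exp_pos[of x] by (simp add: softmax_mean_def inner_sum_left)
  have "0 \<le> (\<Sum>v\<in>V. exp (v \<bullet> x) * (v \<bullet> h - ?m \<bullet> h)\<^sup>2)"
    by (intro sum_nonneg) auto
  also have "\<dots> = (\<Sum>v\<in>V. exp (v \<bullet> x) * (v \<bullet> h)\<^sup>2) - 2 * (?m \<bullet> h) * (\<Sum>v\<in>V. exp (v \<bullet> x) * (v \<bullet> h))
      + (?m \<bullet> h)\<^sup>2 * ?S"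
    unfolding sum_distrib_left sum_subtractf [symmetric] sum.distrib [symmetric]
    by (intro sum.cong) (auto simp: power2_eq_square algebra_simps)
  also have "\<dots> = (\<Sum>v\<in>V. exp (v \<bullet> x) * (v \<bullet> h)\<^sup>2) - ?S * (?m \<bullet> h)\<^sup>2"
    by (simp add: Sm[symmetric] power2_eq_square)
  also have "\<dots> = ?S * (softmax_cov V x h \<bullet> h)"
    using sum_exp_pos[of x]
    by (simp add: softmax_cov_def inner_diff_left inner_sum_left power2_eq_square algebra_simps)
  finally show ?thesis
    using sum_exp_pos[of x] by (simp add: zero_le_mult_iff)
qed

lemma softmax_mean_in_hull: "softmax_mean V x \<in> convex hull V"
proof -
  have "(\<Sum>v\<in>V. (exp (v \<bullet> x) / (\<Sum>v\<in>V. exp (v \<bullet> x))) *\<^sub>R v) \<in> convex hull V"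
    using sum_exp_pos[of x] fin
    by (intro convex_sum) (auto simp: sum_divide_distrib[symmetric] hull_inc)
  then show ?thesis
    by (simp add: softmax_mean_def scaleR_sum_right divide_inverse mult.commute)
qed

text \<open>One exponential is at most the sum. The bound supplies the growth at infinity needed in
  \<open>gradient_map_range\<close>.\<close>

lemma inner_le_log_sum_exp:
  assumes "w \<in> convex hull V"
  shows "w \<bullet> x \<le> log_sum_exp V x"
proof -
  have "v \<bullet> x \<le> log_sum_exp V x" if "v \<in> V" for v
  proof -
    have "exp (v \<bullet> x) \<le> (\<Sum>v\<in>V. exp (v \<bullet> x))"
      using that fin by (intro member_le_sum) auto
    then show ?thesis
      unfolding log_sum_exp_def by (simp add: ln_ge_iff sum_exp_pos)
  qed
  then have "convex hull V \<subseteq> {w. x \<bullet> w \<le> log_sum_exp V x}"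
    by (intro hull_minimal convex_halfspace_le) (auto simp: inner_commute)
  then show ?thesis
    using assms by (auto simp: inner_commute)
qed

end

text \<open>Gradient of \<open>sqrt (1 + x \<bullet> x)\<close>, a strictly convex function whose
  gradients fill the open unit ball; it turns the semidefinite covariances into a definite
  sum.\<close>

definition ball_map :: "'a::euclidean_space \<Rightarrow> 'a" where
  "ball_map x = x /\<^sub>R sqrt (1 + x \<bullet> x)"

definition ball_map_deriv :: "'a::euclidean_space \<Rightarrow> 'a \<Rightarrow> 'a" where
  "ball_map_deriv x h = h /\<^sub>R sqrt (1 + x \<bullet> x) - ((x \<bullet> h) / (sqrt (1 + x \<bullet> x)) ^ 3) *\<^sub>R x"

lemma one_plus_inner_pos: "1 + x \<bullet> x > 0" for x :: "'a::real_inner"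
  by (simp add: add_pos_nonneg)

lemma sqrt_one_plus_has_derivative:
  "((\<lambda>x. sqrt (1 + x \<bullet> x)) has_derivative (\<lambda>h. ball_map x \<bullet> h)) (at (x :: 'a::euclidean_space))"
proof -
  have "((\<lambda>x :: 'a. 1 + x \<bullet> x) has_derivative (\<lambda>h. 2 * (x \<bullet> h))) (at x)"
    by (auto intro!: derivative_eq_intros simp: inner_commute)
  from has_derivative_real_sqrt[OF one_plus_inner_pos this]
  have "((\<lambda>x :: 'a. sqrt (1 + x \<bullet> x)) has_derivative
      (\<lambda>h. 2 * (x \<bullet> h) * (inverse (sqrt (1 + x \<bullet> x)) / 2))) (at x)" .
  moreover have "2 * (x \<bullet> h) * (inverse E / 2) = (x /\<^sub>R E) \<bullet> h" for h E
    by simp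
  ultimately show ?thesis
    unfolding ball_map_def by (simp only:)
qed

lemma ball_map_has_derivative: "(ball_map has_derivative ball_map_deriv x) (at x)"
proof -
  let ?E = "\<lambda>x :: 'a. sqrt (1 + x \<bullet> x)"
  have "((\<lambda>x. inverse (?E x)) has_derivative (\<lambda>h. - (inverse (?E x) * (ball_map x \<bullet> h) * inverse (?E x)))) (at x)"
    using one_plus_inner_pos[of x]
    by (intro Deriv.has_derivative_inverse[OF _ sqrt_one_plus_has_derivative]) auto
  from has_derivative_scaleR[OF this has_derivative_ident]
  have "((\<lambda>x. inverse (?E x) *\<^sub>R x) has_derivative
    (\<lambda>h. inverse (?E x) *\<^sub>R h + (- (inverse (?E x) * (ball_map x \<bullet> h) * inverse (?E x))) *\<^sub>R x)) (at x)" .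
  moreover have "inverse E *\<^sub>R h + (- (inverse E * ((x /\<^sub>R E) \<bullet> h) * inverse E)) *\<^sub>R x
      = h /\<^sub>R E - ((x \<bullet> h) / E ^ 3) *\<^sub>R x" for h E
    by (simp add: power3_eq_cube divide_inverse mult_ac)
  ultimately show ?thesis
    unfolding ball_map_def [abs_def] ball_map_deriv_def [abs_def]
    by (simp only:)
qed

text \<open>Up to the factor E^3 the form is E^2 |h|^2 - (x . h)^2, and Cauchy-Schwarz leaves at
  least |h|^2.\<close>

lemma ball_map_deriv_pos:
  assumes "h \<noteq> 0"
  shows "ball_map_deriv x h \<bullet> h > 0"
proof -
  define E where "E = sqrt (1 + x \<bullet> x)"
  have E: "E > 0" "E\<^sup>2 = 1 + x \<bullet> x"
    using one_plus_inner_pos[of x] by (auto simp: E_def)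
  have "(x \<bullet> h)\<^sup>2 \<le> (x \<bullet> x) * (h \<bullet> h)"
    by (rule Cauchy_Schwarz_ineq)
  moreover have "h \<bullet> h > 0" "E\<^sup>2 * (h \<bullet> h) = h \<bullet> h + (x \<bullet> x) * (h \<bullet> h)"
    using assms E(2) by (simp_all add: algebra_simps)
  ultimately have "E\<^sup>2 * (h \<bullet> h) - (x \<bullet> h)\<^sup>2 > 0"
    by linarith
  moreover have "ball_map_deriv x h \<bullet> h = (E\<^sup>2 * (h \<bullet> h) - (x \<bullet> h)\<^sup>2) / E ^ 3"
    using E(1) unfolding ball_map_deriv_def E_def[symmetric]
    by (simp add: inner_diff_left divide_simps power2_eq_square power3_eq_cube algebra_simps)
  ultimately show ?thesis
    using E(1) by simp
qed

lemma norm_ball_map_less: "norm (ball_map x) < 1"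
proof -
  have "norm x < sqrt (1 + x \<bullet> x)"
    by (rule real_less_rsqrt) (simp add: power2_norm_eq_inner)
  then show ?thesis
    using one_plus_inner_pos[of x] by (simp add: ball_map_def divide_simps)
qed

text \<open>Along the segment from \<open>y\<close> to \<open>x\<close> the component of
  \<open>f\<close> in direction \<open>x - y\<close> is strictly increasing.\<close>

lemma inj_pos_def_derivative:
  fixes f :: "'a::euclidean_space \<Rightarrow> 'a"
  assumes der: "\<And>x. (f has_derivative f' x) (at x)" and pos: "\<And>x h. h \<noteq> 0 \<Longrightarrow> f' x h \<bullet> h > 0"
  shows "inj f"
proof (rule injI, rule ccontr)
  fix x y assume eq: "f x = f y" and "x \<noteq> y"
  define g where "g = (\<lambda>s::real. f (y + s *\<^sub>R (x - y)) \<bullet> (x - y))"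
  have "(g has_real_derivative (f' (y + s *\<^sub>R (x - y)) (x - y) \<bullet> (x - y))) (at s)" for s
  proof -
    have "((\<lambda>s. y + s *\<^sub>R (x - y)) has_derivative (\<lambda>s. s *\<^sub>R (x - y))) (at s)"
      by (auto intro!: derivative_eq_intros)
    from has_derivative_compose[OF this der]
    have "((\<lambda>s. f (y + s *\<^sub>R (x - y))) has_derivative (\<lambda>r. f' (y + s *\<^sub>R (x - y)) (r *\<^sub>R (x - y)))) (at s)" .
    from has_derivative_inner_left[OF this, of "x - y"]
    show ?thesis
      unfolding g_def has_field_derivative_def
      by (rule has_derivative_eq_rhs)
        (use der[THEN has_derivative_linear] in \<open>auto simp: linear_cmul fun_eq_iff\<close>)
  qed
  then have "g 0 < g 1"
    using pos \<open>x \<noteq> y\<close> by (intro DERIV_pos_imp_increasing[of 0 1 g]) fastforce+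
  then show False
    using eq by (simp add: g_def)
qed

definition gradient_map :: "'a::euclidean_space set \<Rightarrow> 'a set \<Rightarrow> real \<Rightarrow> real \<Rightarrow> 'a \<Rightarrow> 'a" where
  "gradient_map V W d t x = softmax_mean V x + t *\<^sub>R softmax_mean W x + d *\<^sub>R ball_map x"

text \<open>A point \<open>p\<close> is a value of the gradient once the potential minus the linear
  form \<open>p\<close> has a critical point. For \<open>p\<close> in the open sum this difference
  grows linearly, so it attains a minimum.\<close>

lemma gradient_map_range:
  fixes V W :: "'a::euclidean_space set"
  assumes V: "finite V" "V \<noteq> {}" and W: "finite W" "W \<noteq> {}" and t: "t \<ge> 0" and d: "d > 0"
  shows "range (gradient_map V W d t) = convex hull V + (*\<^sub>R) t ` (convex hull W) + ball 0 d"
proof (intro equalityI subsetI)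
  fix p assume "p \<in> range (gradient_map V W d t)"
  then obtain x where p: "p = gradient_map V W d t x" by auto
  have "d *\<^sub>R ball_map x \<in> ball 0 d"
    using norm_ball_map_less[of x] d by simp
  then show "p \<in> convex hull V + (*\<^sub>R) t ` (convex hull W) + ball 0 d"
    unfolding p gradient_map_def
    using softmax_mean_in_hull[OF V] softmax_mean_in_hull[OF W] by (intro set_plus_intro imageI)
next
  fix p assume "p \<in> convex hull V + (*\<^sub>R) t ` (convex hull W) + ball 0 d"
  then obtain v w u where v: "v \<in> convex hull V" and w: "w \<in> convex hull W" and u: "norm u < d"
    and p: "p = v + t *\<^sub>R w + u"
    by (auto elim!: set_plus_elim)
  define F where "F = (\<lambda>x. log_sum_exp V x + t * log_sum_exp W x + d * sqrt (1 + x \<bullet> x) - p \<bullet> x)"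
  have der: "(F has_derivative (\<lambda>h. (gradient_map V W d t x - p) \<bullet> h)) (at x)" for x
  proof -
    have "(F has_derivative (\<lambda>h. softmax_mean V x \<bullet> h + t * (softmax_mean W x \<bullet> h) + d * (ball_map x \<bullet> h) - p \<bullet> h)) (at x)"
      unfolding F_def
      by (intro has_derivative_diff has_derivative_add has_derivative_mult_right has_derivative_inner_right
          log_sum_exp_has_derivative V W sqrt_one_plus_has_derivative has_derivative_ident)
    then show ?thesis
      by (simp add: gradient_map_def inner_diff_left inner_add_left)
  qed
  \<comment> \<open>The distance of \<open>u\<close> from the boundary of the ball becomes the slope
    of the lower bound on \<open>F\<close>.\<close>
  define c where "c = d - norm u"
  have c: "c > 0" using u by (simp add: c_def)
  have lower: "F x \<ge> c * norm x" for x
  proof -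
    have "norm x \<le> sqrt (1 + x \<bullet> x)"
      by (rule real_le_rsqrt) (simp add: power2_norm_eq_inner)
    then have "d * norm x \<le> d * sqrt (1 + x \<bullet> x)"
      using d by simp
    moreover have "u \<bullet> x \<le> norm u * norm x"
      by (rule norm_cauchy_schwarz)
    moreover have "v \<bullet> x \<le> log_sum_exp V x" "t * (w \<bullet> x) \<le> t * log_sum_exp W x"
      using inner_le_log_sum_exp V W v w t by (auto intro!: mult_left_mono)
    ultimately show ?thesis
      by (simp add: F_def p c_def inner_add_left algebra_simps)
  qed
  \<comment> \<open>Outside \<open>cball 0 R\<close> the lower bound exceeds \<open>F 0\<close>, so
    a minimum on this ball is global.\<close>
  define R where "R = F 0 / c"
  have "F 0 \<ge> 0" using lower[of 0] by simp
  then have R: "R \<ge> 0" using c by (simp add: R_def)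
  have "continuous_on (cball 0 R) F"
    using der by (meson continuous_at_imp_continuous_on has_derivative_continuous)
  then obtain x where x: "x \<in> cball 0 R" and min: "\<And>y. y \<in> cball 0 R \<Longrightarrow> F x \<le> F y"
    using continuous_attains_inf[of "cball 0 R" F] R by auto
  have "F x \<le> F y" for y
  proof (cases "norm y \<le> R")
    case False
    then have "F 0 < c * norm y"
      using c by (simp add: R_def field_simps)
    then show ?thesis
      using lower[of y] min[of 0] R by simp
  qed (use min in auto)
  then have "(\<lambda>h. (gradient_map V W d t x - p) \<bullet> h) = (\<lambda>h. 0)"
    by (intro differential_zero_maxmin[OF _ open_UNIV der]) auto
  then have "(gradient_map V W d t x - p) \<bullet> (gradient_map V W d t x - p) = 0"
    by metis
  then show "p \<in> range (gradient_map V W d t)"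
    by (metis eq_iff_diff_eq_0 inner_eq_zero_iff rangeI)
qed

lemma open_set_plus:
  fixes S T :: "'a::real_normed_vector set"
  assumes "open T"
  shows "open (S + T)"
proof -
  have "S + T = (\<Union>x\<in>S. \<Union>y\<in>T. {x + y})"
    by (auto simp: set_plus_def)
  then show ?thesis
    using open_sums[of S T] assms by simp
qed

lemma bounded_set_plus:
  fixes S T :: "'a::real_normed_vector set"
  assumes "bounded S" "bounded T"
  shows "bounded (S + T)"
proof -
  have "S + T = (\<Union>x\<in>S. \<Union>y\<in>T. {x + y})"
    by (auto simp: set_plus_def)
  then show ?thesis
    using bounded_sums[OF assms] by simp
qed

lemma compact_set_plus:
  fixes S T :: "'a::real_normed_vector set"
  assumes "compact S" "compact T"
  shows "compact (S + T)"
proof -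
  have "S + T = {x + y | x y. x \<in> S \<and> y \<in> T}"
    by (auto simp: set_plus_def)
  then show ?thesis
    using compact_sums[OF assms] by simp
qed

text \<open>Change of variables gives the volume as the integral of the Jacobian determinant.
  Interpolation holds for the integrand at each \<open>x\<close> and is then integrated.\<close>

lemma measure_polytope_interpolation:
  fixes V W :: "(real^'n::{finite,wellorder}) set"
  assumes V: "finite V" "V \<noteq> {}" and W: "finite W" "W \<noteq> {}" and t: "t \<ge> 0" and d: "d > 0"
  shows "measure lebesgue (convex hull V + (*\<^sub>R) t ` (convex hull W) + ball 0 d)
    = (\<Sum>j\<le>CARD('n). poly (lagrange_basis CARD('n) j) t *
        measure lebesgue (convex hull V + (*\<^sub>R) (real j) ` (convex hull W) + ball 0 d))"
proof -
  define Q where "Q = (\<lambda>t. convex hull V + (*\<^sub>R) t ` (convex hull W) + ball 0 d)"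
  define G where "G = (\<lambda>t x h. softmax_cov V x h + t *\<^sub>R softmax_cov W x h + d *\<^sub>R ball_map_deriv x h)"
  have der: "(gradient_map V W d t has_derivative G t x) (at x)" for t x
    unfolding gradient_map_def [abs_def] G_def
    by (intro has_derivative_add has_derivative_scaleR_right softmax_mean_has_derivative V W ball_map_has_derivative)
  have pos: "G t x h \<bullet> h > 0" if "t \<ge> 0" "h \<noteq> 0" for t x h
    using softmax_cov_nonneg[OF V, of x h] softmax_cov_nonneg[OF W, of x h] ball_map_deriv_pos[OF that(2), of x] d that
    by (simp add: G_def inner_add_left add_nonneg_pos)
  have lin: "linear (G t x)" for t x
    using der by (rule has_derivative_linear)
  have det_pos: "det (matrix (G t x)) > 0" if "t \<ge> 0" for t x
    using lin pos[OF that] by (rule det_pos_of_pos_def)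
  have Qm: "Q t \<in> lmeasurable" for t
    unfolding Q_def
    by (intro lmeasurable_open open_set_plus bounded_set_plus bounded_scaling)
      (auto intro!: finite_imp_bounded_convex_hull V W)
  have integral: "((\<lambda>x. det (matrix (G t x))) has_integral measure lebesgue (Q t)) UNIV" if "t \<ge> 0" for t
  proof -
    have "inj (gradient_map V W d t)"
      using der pos[OF that] by (rule inj_pos_def_derivative)
    then have "range (gradient_map V W d t) \<in> lmeasurable \<and> measure lebesgue (range (gradient_map V W d t)) = m
        \<longleftrightarrow> ((\<lambda>x. \<bar>det (matrix (G t x))\<bar>) has_integral m) UNIV" for m
      by (intro has_measure_differentiable_image der) auto
    moreover have "range (gradient_map V W d t) = Q t"
      unfolding Q_def using V W that d by (rule gradient_map_range)
    ultimately have "((\<lambda>x. \<bar>det (matrix (G t x))\<bar>) has_integral measure lebesgue (Q t)) UNIV"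
      using Qm[of t] by metis
    \<comment> \<open>Only without the absolute value is the integrand a polynomial in
      \<open>t\<close>; this is where definiteness for nonnegative \<open>t\<close> enters.\<close>
    then show ?thesis
      by (simp only: abs_of_pos[OF det_pos[OF that]])
  qed
  have interp: "det (matrix (G t x)) = (\<Sum>j\<le>CARD('n). poly (lagrange_basis CARD('n) j) t * det (matrix (G (real j) x)))" for t x
  proof -
    define A where "A = matrix (G 0 x)"
    define B where "B = matrix (softmax_cov W x)"
    have G_eq: "matrix (G t x) = A + t *\<^sub>R B" for t
      by (simp add: A_def B_def G_def matrix_def vec_eq_iff)
    obtain p where p: "degree p \<le> CARD('n)" "\<And>t. det (A + t *\<^sub>R B) = poly p t"
      using det_linear_pencil_poly by blast
    have "poly p t = (\<Sum>j\<le>CARD('n). poly (lagrange_basis CARD('n) j) t * poly p (real j))" for t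
      by (subst lagrange_interpolation[OF p(1)]) (simp add: poly_sum mult.commute)
    then show ?thesis
      unfolding G_eq p(2) .
  qed
  have "((\<lambda>x. det (matrix (G t x))) has_integral
      (\<Sum>j\<le>CARD('n). poly (lagrange_basis CARD('n) j) t * measure lebesgue (Q (real j)))) UNIV"
    by (subst interp) (intro has_integral_sum has_integral_mult_right integral; simp)
  from has_integral_unique[OF integral[OF t] this] show ?thesis
    by (simp add: Q_def)
qed

subsection \<open>Passage to convex bodies\<close>

lemma compact_finite_net:
  fixes K :: "'a::metric_space set"
  assumes "compact K" "e > 0" "K \<noteq> {}"
  obtains V where "finite V" "V \<noteq> {}" "V \<subseteq> K" "\<And>x. x \<in> K \<Longrightarrow> \<exists>v\<in>V. dist x v < e"
proof -
  obtain V where V: "V \<subseteq> K" "finite V" "K \<subseteq> (\<Union>v\<in>V. ball v e)"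
    using compactE_image[OF assms(1), of K "\<lambda>v. ball v e"] assms(2) by (metis UN_upper centre_in_ball open_ball subsetI UN_I)
  moreover have "V \<noteq> {}"
    using V(3) assms(3) by auto
  moreover have "\<exists>v\<in>V. dist x v < e" if "x \<in> K" for x
    using subsetD[OF V(3) that] by (auto simp: dist_commute)
  ultimately show ?thesis
    using that by blast
qed

text \<open>The parallel bodies decrease to \<open>C\<close> because \<open>C\<close> is closed;
  then measure is continuous from above.\<close>

lemma measure_parallel_body_tendsto:
  fixes C :: "'a::euclidean_space set"
  assumes C: "compact C" and c: "c \<ge> 0"
  shows "(\<lambda>k. measure lebesgue (C + cball 0 (c / (real k + 1)))) \<longlonglongrightarrow> measure lebesgue C"
proof -
  let ?A = "\<lambda>k. C + cball 0 (c / (real k + 1))"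
  have comp: "compact (?A k)" for k
    by (intro compact_set_plus C compact_cball)
  have "(\<lambda>k. measure lebesgue (?A k)) \<longlonglongrightarrow> measure lebesgue (\<Inter>k. ?A k)"
  proof (rule Lim_measure_decseq)
    show "range ?A \<subseteq> sets lebesgue"
      using comp by (auto simp: lmeasurable_compact fmeasurableD)
    show "emeasure lebesgue (?A k) \<noteq> \<infinity>" for k
      using comp[of k] by (metis fmeasurableD2 lmeasurable_compact infinity_ennreal_def)
    have "c / (real l + 1) \<le> c / (real k + 1)" if "k \<le> l" for k l
      using that c by (intro divide_left_mono) (auto intro!: mult_pos_pos)
    then show "decseq ?A"
      by (intro antimonoI set_plus_mono2 subset_cball order_refl)
  qed
  also have "(\<Inter>k. ?A k) = C"
  proof (intro equalityI subsetI)
    fix x assume x: "x \<in> C"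
    have "x + 0 \<in> ?A k" for k
      using x c by (intro set_plus_intro) auto
    then show "x \<in> (\<Inter>k. ?A k)"
      by simp
  next
    fix x assume x: "x \<in> (\<Inter>k. ?A k)"
    have "\<exists>y\<in>C. dist y x < e" if e: "e > 0" for e
    proof -
      obtain k where k: "c / e < real k"
        using reals_Archimedean2 by blast
      have "x \<in> ?A k" using x by blast
      then obtain y u where y: "y \<in> C" "norm u \<le> c / (real k + 1)" "x = y + u"
        by (auto elim!: set_plus_elim)
      have "c / (real k + 1) < e"
        using k e by (simp add: field_simps)
      then show ?thesis
        using y by (intro bexI[of _ y]) (auto simp: dist_norm)
    qed
    then show "x \<in> C"
      using closure_approachable[of x C] C compact_imp_closed closure_closed by metis
  qed
  finally show ?thesis .
qed

lemma measure_minkowski_interpolation_cart: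
  fixes K M :: "(real^'n::{finite,wellorder}) set"
  assumes K: "convex_body K" and M: "convex_body M" and t: "t \<ge> 0"
  shows "measure lebesgue (M + (*\<^sub>R) t ` K)
    = (\<Sum>j\<le>CARD('n). poly (lagrange_basis CARD('n) j) t * measure lebesgue (M + (*\<^sub>R) (real j) ` K))"
proof -
  \<comment> \<open>One radius has to serve \<open>t\<close> and all nodes up to the
    dimension.\<close>
  define T where "T = max t (real CARD('n))"
  \<comment> \<open>The nets contribute less than 1 / (k + 1) through \<open>M\<close> and at most T
    / (k + 1) through the dilate of \<open>K\<close>, so \<open>P k s\<close> contains the limit
    body.\<close>
  define r where "r = (\<lambda>k::nat. (1 + T) / (real k + 1))"
  have comp: "compact K" "compact M" "K \<noteq> {}" "M \<noteq> {}" "convex K" "convex M"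
    using K M by (auto simp: convex_body_def)
  define net where
    "net = (\<lambda>S k (V :: (real^'n::{finite,wellorder}) set). finite V \<and> V \<noteq> {} \<and> V \<subseteq> S \<and> (\<forall>x\<in>S. \<exists>v\<in>V. dist x v < 1 / (real k + 1)))"
  have "\<exists>V. net S k V" if S: "compact S" "S \<noteq> {}" for S k
  proof -
    have "1 / (real k + 1) > 0" by simp
    from compact_finite_net[OF S(1) this S(2)] show ?thesis
      unfolding net_def by metis
  qed
  then obtain V W where "\<And>k. net M k (V k)" "\<And>k. net K k (W k)"
    using comp by metis
  then have VW: "finite (V k) \<and> V k \<noteq> {} \<and> V k \<subseteq> M \<and> finite (W k) \<and> W k \<noteq> {} \<and> W k \<subseteq> K
      \<and> (\<forall>x\<in>M. \<exists>v\<in>V k. dist x v < 1 / (real k + 1)) \<and> (\<forall>x\<in>K. \<exists>w\<in>W k. dist x w < 1 / (real k + 1))" for k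
    unfolding net_def by (metis (no_types))
  define P where "P = (\<lambda>k s. convex hull V k + (*\<^sub>R) s ` (convex hull W k) + ball 0 (r k))"
  have r: "r k > 0" for k
    unfolding r_def T_def by (intro divide_pos_pos) (auto simp: max_def)
  have lim: "(\<lambda>k. measure lebesgue (P k s)) \<longlonglongrightarrow> measure lebesgue (M + (*\<^sub>R) s ` K)"
    if s: "0 \<le> s" "s \<le> T" for s
  proof (rule tendsto_sandwich[of "\<lambda>_. measure lebesgue (M + (*\<^sub>R) s ` K)" _ _
        "\<lambda>k. measure lebesgue (M + (*\<^sub>R) s ` K + cball 0 ((1 + T) / (real k + 1)))"])
    have cMK: "compact (M + (*\<^sub>R) s ` K)"
      by (intro compact_set_plus compact_scaling comp)
    show "(\<lambda>k. measure lebesgue (M + (*\<^sub>R) s ` K + cball 0 ((1 + T) / (real k + 1))))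
        \<longlonglongrightarrow> measure lebesgue (M + (*\<^sub>R) s ` K)"
      using measure_parallel_body_tendsto[OF cMK] s by simp
    have hull: "convex hull V k \<subseteq> M" "convex hull W k \<subseteq> K" for k
      using VW[of k] comp by (simp_all add: hull_minimal)
    have "M + (*\<^sub>R) s ` K \<subseteq> P k s" for k
    proof
      fix x assume "x \<in> M + (*\<^sub>R) s ` K"
      then obtain m a where ma: "m \<in> M" "a \<in> K" "x = m + s *\<^sub>R a"
        by (auto elim!: set_plus_elim)
      then obtain v w where vw: "v \<in> V k" "dist m v < 1 / (real k + 1)" "w \<in> W k" "dist a w < 1 / (real k + 1)"
        using VW[of k] by meson
      have "norm ((m - v) + s *\<^sub>R (a - w)) \<le> norm (m - v) + s * norm (a - w)"
        using norm_triangle_ineq[of "m - v" "s *\<^sub>R (a - w)"] s by simp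
      also have "s * norm (a - w) \<le> T * (1 / (real k + 1))"
        using vw s by (intro mult_mono) (auto simp: dist_norm)
      also have "norm (m - v) + T * (1 / (real k + 1)) < r k"
        using vw(2) by (simp add: r_def dist_norm add_divide_distrib)
      finally have "(m - v) + s *\<^sub>R (a - w) \<in> ball 0 (r k)"
        by simp
      then have "v + s *\<^sub>R w + ((m - v) + s *\<^sub>R (a - w)) \<in> P k s"
        unfolding P_def using vw by (intro set_plus_intro imageI) (auto intro: hull_inc)
      then show "x \<in> P k s"
        by (simp add: ma algebra_simps)
    qed
    moreover have Pm: "P k s \<in> lmeasurable" for k
      unfolding P_def using VW[of k]
      by (intro lmeasurable_open open_set_plus bounded_set_plus bounded_scaling)
        (auto intro!: finite_imp_bounded_convex_hull)
    ultimately show "\<forall>\<^sub>F k in sequentially. measure lebesgue (M + (*\<^sub>R) s ` K) \<le> measure lebesgue (P k s)"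
      by (intro always_eventually allI measure_mono_fmeasurable)
        (auto simp: cMK fmeasurableD lmeasurable_compact)
    have "P k s \<subseteq> M + (*\<^sub>R) s ` K + cball 0 ((1 + T) / (real k + 1))" for k
      unfolding P_def r_def using hull[of k] by (intro set_plus_mono2 image_mono) auto
    then show "\<forall>\<^sub>F k in sequentially. measure lebesgue (P k s) \<le>
        measure lebesgue (M + (*\<^sub>R) s ` K + cball 0 ((1 + T) / (real k + 1)))"
      using Pm by (intro always_eventually allI measure_mono_fmeasurable)
        (auto simp: fmeasurableD intro!: lmeasurable_compact compact_set_plus cMK)
  qed simp
  have "measure lebesgue (P k t) = (\<Sum>j\<le>CARD('n). poly (lagrange_basis CARD('n) j) t * measure lebesgue (P k (real j)))" for k
    unfolding P_def using VW[of k] t r[of k] by (intro measure_polytope_interpolation) auto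
  moreover have "(\<lambda>k. \<Sum>j\<le>CARD('n). poly (lagrange_basis CARD('n) j) t * measure lebesgue (P k (real j)))
      \<longlonglongrightarrow> (\<Sum>j\<le>CARD('n). poly (lagrange_basis CARD('n) j) t * measure lebesgue (M + (*\<^sub>R) (real j) ` K))"
    by (intro tendsto_sum tendsto_mult_left lim) (auto simp: T_def)
  ultimately show ?thesis
    using LIMSEQ_unique[OF lim[of t]] t by (simp add: T_def)
qed

subsection \<open>Coordinates\<close>

text \<open>Index type for coordinates: it makes \<open>'a\<close> isometric to a
  \<open>real^'n\<close> with finite, well-ordered \<open>'n\<close>, the setting of the determinant
  argument.\<close>

typedef (overloaded) 'a basis_index = "Basis :: 'a::euclidean_space set"
  by (meson nonempty_Basis ex_in_conv)

instance basis_index :: (euclidean_space) finite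
  by standard (simp add: type_definition.univ[OF type_definition_basis_index])

instantiation basis_index :: (euclidean_space) wellorder
begin

definition basis_rank :: "'a basis_index \<Rightarrow> nat" where
  "basis_rank = (SOME f. inj f)"

definition less_eq_basis_index :: "'a basis_index \<Rightarrow> 'a basis_index \<Rightarrow> bool" where
  "less_eq_basis_index i j \<longleftrightarrow> basis_rank i \<le> basis_rank j"

definition less_basis_index :: "'a basis_index \<Rightarrow> 'a basis_index \<Rightarrow> bool" where
  "less_basis_index i j \<longleftrightarrow> basis_rank i < basis_rank j"

lemma inj_basis_rank: "inj (basis_rank :: 'a basis_index \<Rightarrow> nat)"
proof -
  obtain f :: "'a basis_index \<Rightarrow> nat" and n where "f ` UNIV = {i. i < n} \<and> inj f"
    using finite_imp_inj_to_nat_seg[OF finite[of "UNIV :: 'a basis_index set"]] by meson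
  then show ?thesis
    unfolding basis_rank_def by (intro someI[of inj f]) simp
qed

instance
proof
  show "P a" if "\<And>x. (\<And>y. y < x \<Longrightarrow> P y) \<Longrightarrow> P x" for P and a :: "'a basis_index"
    by (rule measure_induct_rule[of basis_rank]) (use that in \<open>auto simp: less_basis_index_def\<close>)
qed (auto simp: less_eq_basis_index_def less_basis_index_def injD[OF inj_basis_rank])

end

definition to_cart :: "'a::euclidean_space \<Rightarrow> real ^ 'a basis_index" where
  "to_cart x = (\<chi> i. x \<bullet> Rep_basis_index i)"

definition of_cart :: "real ^ 'a basis_index \<Rightarrow> 'a::euclidean_space" where
  "of_cart v = (\<Sum>i\<in>UNIV. v $ i *\<^sub>R Rep_basis_index i)"

lemma to_cart_nth [simp]: "to_cart x $ i = x \<bullet> Rep_basis_index i"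
  by (simp add: to_cart_def)

lemma range_Rep_basis_index: "range Rep_basis_index = Basis"
  using type_definition.Rep_range[OF type_definition_basis_index] .

lemma inj_Rep_basis_index: "inj Rep_basis_index"
  by (simp add: inj_def Rep_basis_index_inject)

lemma of_cart_to_cart [simp]: "of_cart (to_cart x) = x"
proof -
  have "of_cart (to_cart x) = (\<Sum>b\<in>range Rep_basis_index. (x \<bullet> b) *\<^sub>R b)"
    by (simp add: of_cart_def to_cart_def sum.reindex inj_Rep_basis_index)
  then show ?thesis
    by (simp add: range_Rep_basis_index euclidean_representation)
qed

lemma to_cart_of_cart [simp]: "to_cart (of_cart v) = v"
  by (simp add: of_cart_def to_cart_def vec_eq_iff inner_sum_left inner_Basis Rep_basis_index
      Rep_basis_index_inject if_distrib sum.delta cong: if_cong)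

lemma linear_to_cart: "linear to_cart"
  by (auto intro!: linearI simp: to_cart_def vec_eq_iff inner_add_left)

lemma linear_of_cart: "linear of_cart"
  by (auto intro!: linearI simp: of_cart_def scaleR_add_left sum.distrib scaleR_sum_right)

lemma inner_to_cart [simp]: "to_cart x \<bullet> to_cart y = x \<bullet> y"
proof -
  have "to_cart x \<bullet> to_cart y = (\<Sum>b\<in>range Rep_basis_index. (x \<bullet> b) * (y \<bullet> b))"
    by (simp add: inner_vec_def to_cart_def sum.reindex inj_Rep_basis_index)
  then show ?thesis
    by (simp add: range_Rep_basis_index euclidean_inner[symmetric])
qed

lemma CARD_basis_index: "CARD('a::euclidean_space basis_index) = DIM('a)"
  by (metis card_image inj_Rep_basis_index range_Rep_basis_index)

text \<open>Boxes correspond to boxes with the same sides, and this determines Lebesgue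
  measure.\<close>

lemma lborel_of_cart: "lborel = distr lborel borel (of_cart :: _ \<Rightarrow> 'a::euclidean_space)"
proof (rule lborel_eqI)
  fix l u :: 'a assume le: "\<And>b. b \<in> Basis \<Longrightarrow> l \<bullet> b \<le> u \<bullet> b"
  have [measurable]: "of_cart \<in> borel_measurable borel"
    by (intro borel_measurable_continuous_onI linear_continuous_on linear_conv_bounded_linear[THEN iffD1] linear_of_cart)
  have cart_Basis: "(Basis :: (real ^ 'a basis_index) set) = range (\<lambda>i. axis i 1)"
    by (auto simp: Basis_vec_def)
  have inj_axis: "inj (\<lambda>i :: 'a basis_index. axis i (1::real))"
    by (simp add: inj_def axis_eq_axis)
  have "of_cart -` box l u = box (to_cart l) (to_cart u)"
  proof (intro set_eqI)
    fix v :: "real ^ 'a basis_index"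
    obtain x where v: "v = to_cart x" using to_cart_of_cart by metis
    have "x \<in> box l u \<longleftrightarrow> (\<forall>b\<in>range Rep_basis_index. l \<bullet> b < x \<bullet> b \<and> x \<bullet> b < u \<bullet> b)"
      by (simp add: mem_box range_Rep_basis_index)
    then show "v \<in> of_cart -` box l u \<longleftrightarrow> v \<in> box (to_cart l) (to_cart u)"
      by (simp add: v mem_box_cart)
  qed
  then have "emeasure (distr lborel borel of_cart) (box l u) = emeasure lborel (box (to_cart l) (to_cart u))"
    by (simp add: emeasure_distr)
  also have "\<dots> = (\<Prod>b\<in>Basis. (to_cart u - to_cart l) \<bullet> b)"
    using le by (intro emeasure_lborel_box) (auto simp: cart_Basis inner_axis to_cart_def Rep_basis_index)
  also have "(\<Prod>b\<in>Basis. (to_cart u - to_cart l) \<bullet> b) = (\<Prod>b\<in>range Rep_basis_index. (u - l) \<bullet> b)"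
    by (simp add: cart_Basis prod.reindex inj_Rep_basis_index inj_axis inner_axis inner_diff_left)
  finally show "emeasure (distr lborel borel of_cart) (box l u) = ennreal (\<Prod>b\<in>Basis. (u - l) \<bullet> b)"
    by (simp add: range_Rep_basis_index)
qed simp

lemma measure_to_cart_image:
  fixes S :: "'a::euclidean_space set"
  assumes "compact S"
  shows "measure lebesgue (to_cart ` S) = measure lebesgue S"
proof -
  have S: "S \<in> sets borel"
    using assms by (simp add: borel_compact)
  have [measurable]: "of_cart \<in> borel_measurable borel"
    by (intro borel_measurable_continuous_onI linear_continuous_on linear_conv_bounded_linear[THEN iffD1] linear_of_cart)
  have vimage: "of_cart -` S = to_cart ` S"
    by (force simp: image_iff)
  have "compact (to_cart ` S)"
    using assms by (intro compact_continuous_image linear_continuous_on linear_conv_bounded_linear[THEN iffD1] linear_to_cart)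
  then have "measure lebesgue (to_cart ` S) = measure lborel (of_cart -` S)"
    by (simp add: vimage borel_compact)
  also have "\<dots> = measure (distr lborel borel of_cart) S"
    using S by (simp add: measure_distr)
  also have "\<dots> = measure lebesgue S"
    using S by (simp add: lborel_of_cart[symmetric])
  finally show ?thesis .
qed

lemma linear_image_set_plus:
  assumes "linear f"
  shows "f ` (S + T) = f ` S + f ` T"
  using assms by (auto simp: set_plus_def linear_add image_iff) (metis linear_add)+

lemma linear_image_scaleR:
  assumes "linear f"
  shows "f ` ((*\<^sub>R) c ` S) = (*\<^sub>R) c ` f ` S"
  using assms by (auto simp: image_image linear_cmul)

lemma compact_linear_image:
  fixes f :: "'a::euclidean_space \<Rightarrow> 'b::real_normed_vector"
  assumes "linear f" "compact S"
  shows "compact (f ` S)"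
  using assms by (intro compact_continuous_image linear_continuous_on) (simp_all add: linear_conv_bounded_linear)

lemma convex_body_linear_image:
  fixes f :: "'a::euclidean_space \<Rightarrow> 'b::euclidean_space"
  assumes "linear f" "convex_body K"
  shows "convex_body (f ` K)"
  using assms unfolding convex_body_def
  by (auto intro!: compact_linear_image convex_linear_image)

lemma convex_body_plus:
  "convex_body (K :: 'a::euclidean_space set) \<Longrightarrow> convex_body M \<Longrightarrow> convex_body (K + M)"
  unfolding convex_body_def by (intro conjI compact_set_plus convex_set_plus) (auto simp: set_plus_def)

lemma convex_body_scaleR:
  "convex_body (K :: 'a::euclidean_space set) \<Longrightarrow> convex_body ((*\<^sub>R) c ` K)"
  by (rule convex_body_linear_image) simp_all

lemma measure_minkowski_interpolation:
  fixes K M :: "'a::euclidean_space set"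
  assumes K: "convex_body K" and M: "convex_body M" and t: "t \<ge> 0"
  shows "measure lebesgue (M + (*\<^sub>R) t ` K)
    = (\<Sum>j\<le>DIM('a). poly (lagrange_basis DIM('a) j) t * measure lebesgue (M + (*\<^sub>R) (real j) ` K))"
proof -
  have "measure lebesgue (to_cart ` M + (*\<^sub>R) s ` to_cart ` K) = measure lebesgue (M + (*\<^sub>R) s ` K)" for s
  proof -
    have "compact (M + (*\<^sub>R) s ` K)"
      using convex_body_plus[OF M convex_body_scaleR[OF K]] by (simp add: convex_body_def)
    then show ?thesis
      by (metis linear_image_scaleR linear_image_set_plus linear_to_cart measure_to_cart_image)
  qed
  with measure_minkowski_interpolation_cart[OF K[THEN convex_body_linear_image[OF linear_to_cart]]
      M[THEN convex_body_linear_image[OF linear_to_cart]] t]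
  show ?thesis
    by (simp add: CARD_basis_index)
qed

lemma measure_orthogonal_transformation:
  fixes f :: "'a::euclidean_space \<Rightarrow> 'a"
  assumes f: "orthogonal_transformation f" and S: "compact S"
  shows "measure lebesgue (f ` S) = measure lebesgue S"
proof -
  define g where "g = to_cart \<circ> f \<circ> of_cart"
  have lf: "linear f" using f by (rule orthogonal_transformation_linear)
  have "orthogonal_transformation g"
    unfolding orthogonal_transformation_def
  proof (intro conjI allI)
    show "linear g"
      unfolding g_def by (intro linear_compose linear_to_cart linear_of_cart lf)
    show "g v \<bullet> g w = v \<bullet> w" for v w
    proof -
      obtain x y where "v = to_cart x" "w = to_cart y" using to_cart_of_cart by metis
      then show ?thesis
        using f by (simp add: g_def orthogonal_transformation_def)
    qed
  qed
  moreover have "compact (to_cart ` S)"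
    using S by (intro compact_linear_image linear_to_cart)
  ultimately have "measure lebesgue (g ` to_cart ` S) = measure lebesgue (to_cart ` S)"
    by (intro measure_orthogonal_image lmeasurable_compact)
  moreover have "g ` to_cart ` S = to_cart ` f ` S"
    by (simp add: g_def image_image)
  ultimately show ?thesis
    using S lf by (simp add: measure_to_cart_image compact_linear_image)
qed

subsection \<open>The volume polynomial\<close>

abbreviation vol :: "'a::euclidean_space set \<Rightarrow> real" where
  "vol S \<equiv> measure lebesgue S"

text \<open>The interpolant through the values at 0, ..., n: it makes sense before polynomiality is
  invoked, and invariances of the volumes pass to it by rewriting.\<close>

definition vol_poly :: "'a::euclidean_space set \<Rightarrow> 'a set \<Rightarrow> real poly" where
  "vol_poly K M = (\<Sum>j\<le>DIM('a). smult (vol (M + (*\<^sub>R) (real j) ` K)) (lagrange_basis DIM('a) j))"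

text \<open>One has \<open>dvol K M = n * V(K, M[n-1])\<close>.\<close>

definition dvol :: "'a::euclidean_space set \<Rightarrow> 'a set \<Rightarrow> real" where
  "dvol K M = poly.coeff (vol_poly K M) 1"

lemma degree_vol_poly: "degree (vol_poly K M) \<le> DIM('a)" for K :: "'a::euclidean_space set"
  unfolding vol_poly_def
  by (intro degree_sum_le) (auto intro: order_trans[OF degree_smult_le] degree_lagrange_basis)

lemma poly_vol_poly:
  assumes "convex_body K" "convex_body M" "t \<ge> 0"
  shows "poly (vol_poly K M) t = vol (M + (*\<^sub>R) t ` K)"
  using measure_minkowski_interpolation[OF assms] by (simp add: vol_poly_def poly_sum mult.commute)

lemma poly_eq_sum_atMost:
  fixes p :: "'a::comm_semiring_1 poly"
  assumes "degree p \<le> n"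
  shows "poly p x = (\<Sum>i\<le>n. poly.coeff p i * x ^ i)"
  unfolding poly_altdef using assms
  by (intro sum.mono_neutral_left) (auto simp: coeff_eq_0)

lemma poly_eqI_nat:
  fixes p q :: "real poly"
  assumes "\<And>k::nat. k > 0 \<Longrightarrow> poly p (real k) = poly q (real k)"
  shows "p = q"
proof (rule poly_eqI_degree[where A = "real ` {1..Suc (max (degree p) (degree q))}"])
  show "poly p x = poly q x" if "x \<in> real ` {1..Suc (max (degree p) (degree q))}" for x
    using that assms by auto
qed (simp_all add: card_image)

lemma vol_poly_eqI:
  assumes "convex_body K" "convex_body M" "\<And>t. t > 0 \<Longrightarrow> poly p t = vol (M + (*\<^sub>R) t ` K)"
  shows "vol_poly K M = p"
  by (intro poly_eqI_nat) (simp add: assms poly_vol_poly)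

lemma plus_scaleR_0:
  fixes M :: "'a::real_vector set"
  assumes "K \<noteq> {}"
  shows "M + (*\<^sub>R) 0 ` K = M"
  using assms by (auto simp: set_plus_def image_constant_conv)

lemma scaleR_set_plus:
  fixes K M :: "'a::real_vector set"
  shows "(*\<^sub>R) c ` (K + M) = (*\<^sub>R) c ` K + (*\<^sub>R) c ` M"
  by (rule linear_image_set_plus) simp

lemma scaleR_scaleR_image:
  fixes K :: "'a::real_vector set"
  shows "(*\<^sub>R) c ` (*\<^sub>R) d ` K = (*\<^sub>R) (c * d) ` K"
  by (simp add: image_image)

lemma vol_scaleR: "vol ((*\<^sub>R) c ` S) = \<bar>c\<bar> ^ DIM('a) * vol S" for S :: "'a::euclidean_space set"
  using measure_lebesgue_affine[of c 0 S] by simp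

lemma coeff_vol_poly_0:
  assumes "convex_body K" "convex_body M"
  shows "poly.coeff (vol_poly K M) 0 = vol M"
proof -
  have "K \<noteq> {}" using assms by (simp add: convex_body_def)
  then show ?thesis
    using poly_vol_poly[OF assms order_refl] by (simp only: poly_0_coeff_0 plus_scaleR_0 not_False_eq_True)
qed

lemma tendsto_eventually_eqI:
  assumes "(f \<longlongrightarrow> l) F" "l = l'" "\<forall>\<^sub>F x in F. f x = g x"
  shows "(g \<longlongrightarrow> l') F"
  using assms(1) unfolding tendsto_cong[OF assms(3)] assms(2) .

text \<open>This one-sided derivative is how inequalities between volumes reach
  \<open>dvol\<close>.\<close>

lemma dvol_tendsto:
  assumes "convex_body K" "convex_body M"
  shows "((\<lambda>t. (vol (M + (*\<^sub>R) t ` K) - vol M) / t) \<longlongrightarrow> dvol K M) (at_right 0)"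
proof -
  obtain a q where p: "vol_poly K M = pCons a q"
    by (metis pCons_cases)
  have a: "a = vol M"
    using coeff_vol_poly_0[OF assms] p by simp
  have "(poly q \<longlongrightarrow> poly q 0) (at_right 0)"
    using poly_isCont[of 0 q] by (simp add: isCont_def filterlim_at_split)
  moreover have "poly q 0 = dvol K M"
    by (simp add: dvol_def p poly_0_coeff_0)
  moreover have "\<forall>\<^sub>F t in at_right 0. poly q t = (vol (M + (*\<^sub>R) t ` K) - vol M) / t"
    unfolding eventually_at_right_field
    by (rule exI[of _ 1]) (auto simp: poly_vol_poly[OF assms, symmetric] p a)
  ultimately show ?thesis
    by (rule tendsto_eventually_eqI)
qed

lemma vol_mono:
  fixes S T :: "'a::euclidean_space set"
  assumes "S \<subseteq> T" "compact S" "compact T"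
  shows "vol S \<le> vol T"
  using assms by (intro measure_mono_fmeasurable) (auto simp: lmeasurable_compact fmeasurableD)

lemma compact_plus_scaleR:
  "convex_body (K :: 'a::euclidean_space set) \<Longrightarrow> convex_body M \<Longrightarrow> compact (M + (*\<^sub>R) t ` K)"
  using convex_body_plus convex_body_scaleR convex_body_def by metis

lemma eventually_at_right_0: "(\<And>t::real. t > 0 \<Longrightarrow> P t) \<Longrightarrow> \<forall>\<^sub>F t in at_right 0. P t"
  unfolding eventually_at_right_field by (rule exI[of _ 1]) auto

lemma dvol_mono:
  assumes "convex_body K" "convex_body K'" "convex_body M" "K \<subseteq> K'"
  shows "dvol K M \<le> dvol K' M"
proof (rule tendsto_le[OF _ dvol_tendsto[OF assms(2,3)] dvol_tendsto[OF assms(1,3)]])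
  show "\<forall>\<^sub>F t in at_right 0. (vol (M + (*\<^sub>R) t ` K) - vol M) / t \<le> (vol (M + (*\<^sub>R) t ` K') - vol M) / t"
    using assms
    by (intro eventually_at_right_0 divide_right_mono diff_right_mono vol_mono compact_plus_scaleR set_plus_mono2 image_mono) auto
qed simp

lemma dvol_translation: "dvol ((+) a ` K) M = dvol K M"
proof -
  have "M + (*\<^sub>R) t ` (+) a ` K = (+) (t *\<^sub>R a) ` (M + (*\<^sub>R) t ` K)" for t
    by (auto simp: set_plus_def image_iff algebra_simps) (metis add.left_commute scaleR_right_distrib)+
  then show ?thesis
    by (simp add: dvol_def vol_poly_def measure_translation)
qed

text \<open>Scaling \<open>K\<close> substitutes \<open>c * t\<close> for \<open>t\<close> in the
  volume polynomial.\<close>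

lemma dvol_scaleR:
  assumes "convex_body K" "convex_body M" "c \<ge> 0"
  shows "dvol ((*\<^sub>R) c ` K) M = c * dvol K M"
proof -
  obtain a q where p: "vol_poly K M = pCons a q"
    by (metis pCons_cases)
  have "vol_poly ((*\<^sub>R) c ` K) M = pcompose (vol_poly K M) [:0, c:]"
    using assms
    by (intro vol_poly_eqI convex_body_scaleR) (auto simp: poly_pcompose poly_vol_poly scaleR_scaleR_image mult.commute)
  then show ?thesis
    by (simp add: dvol_def p pcompose_pCons poly_0_coeff_0[symmetric] poly_pcompose)
qed

lemma dvol_orthogonal_image:
  fixes f :: "'a::euclidean_space \<Rightarrow> 'a"
  assumes "orthogonal_transformation f" "convex_body K" "convex_body M"
  shows "dvol (f ` K) (f ` M) = dvol K M"
proof -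
  have "linear f" using assms(1) by (rule orthogonal_transformation_linear)
  then have "f ` M + (*\<^sub>R) t ` f ` K = f ` (M + (*\<^sub>R) t ` K)" for t
    by (simp add: linear_image_set_plus linear_image_scaleR)
  then show ?thesis
    using assms by (simp add: dvol_def vol_poly_def measure_orthogonal_transformation compact_plus_scaleR)
qed

text \<open>Homogeneity, vol (M + t K) = t^n vol (K + M / t), reverses the coefficients. This turns
  V_{n-1}(M) into a first-order coefficient.\<close>

lemma coeff_vol_poly_swap:
  fixes K M :: "'a::euclidean_space set"
  assumes "convex_body K" "convex_body M" "i \<le> DIM('a)"
  shows "poly.coeff (vol_poly K M) (DIM('a) - i) = poly.coeff (vol_poly M K) i"
proof -
  let ?n = "DIM('a)"
  define q where "q = vol_poly M K"
  have "vol_poly K M = (\<Sum>k\<le>?n. monom (poly.coeff q k) (?n - k))"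
  proof (rule vol_poly_eqI[OF assms(1,2)])
    fix t :: real assume t: "t > 0"
    have "poly (\<Sum>k\<le>?n. monom (poly.coeff q k) (?n - k)) t = (\<Sum>k\<le>?n. t ^ ?n * (poly.coeff q k * (1 / t) ^ k))"
      using t by (auto simp: poly_sum poly_monom power_diff power_one_over divide_simps intro!: sum.cong)
    also have "\<dots> = t ^ ?n * poly q (1 / t)"
      using degree_vol_poly[of M K]
      by (simp add: sum_distrib_left[symmetric] q_def poly_eq_sum_atMost)
    also have "poly q (1 / t) = vol (K + (*\<^sub>R) (1 / t) ` M)"
      using assms t by (simp add: q_def poly_vol_poly)
    also have "t ^ ?n * \<dots> = vol ((*\<^sub>R) t ` (K + (*\<^sub>R) (1 / t) ` M))"
      using t by (simp add: vol_scaleR)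
    also have "(*\<^sub>R) t ` (K + (*\<^sub>R) (1 / t) ` M) = M + (*\<^sub>R) t ` K"
      using t by (simp add: scaleR_set_plus scaleR_scaleR_image add.commute)
    finally show "poly (\<Sum>k\<le>?n. monom (poly.coeff q k) (?n - k)) t = vol (M + (*\<^sub>R) t ` K)" .
  qed
  then have "poly.coeff (vol_poly K M) (?n - i) = (\<Sum>k\<le>?n. if ?n - k = ?n - i then poly.coeff q k else 0)"
    by (simp add: coeff_sum)
  also have "\<dots> = (\<Sum>k\<le>?n. if k = i then poly.coeff q k else 0)"
    using assms(3) by (intro sum.cong) auto
  finally show ?thesis
    using assms(3) by (simp add: q_def)
qed

text \<open>The volume polynomial witnesses that an expansion exists, so the choice made in
  \<open>mixed_vol\<close> satisfies one; setting \<beta> = 1 then determines its entries up to the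
  dimension.\<close>

lemma mixed_vol_eq_coeff:
  fixes K M :: "'a::euclidean_space set"
  assumes K: "convex_body K" and M: "convex_body M" and i: "i \<le> DIM('a)"
  shows "mixed_vol K M i = poly.coeff (vol_poly K M) i / real (DIM('a) choose i)"
proof -
  let ?n = "DIM('a)"
  define expansion where "expansion = (\<lambda>c :: nat \<Rightarrow> real. \<forall>\<alpha> \<beta>. \<alpha> \<ge> 0 \<longrightarrow> \<beta> \<ge> 0 \<longrightarrow>
        vol {\<alpha> *\<^sub>R x + \<beta> *\<^sub>R y | x y. x \<in> K \<and> y \<in> M} =
        (\<Sum>j\<le>?n. real (?n choose j) * c j * \<alpha> ^ j * \<beta> ^ (?n - j)))"
  have set_eq: "{\<alpha> *\<^sub>R x + \<beta> *\<^sub>R y | x y. x \<in> K \<and> y \<in> M} = (*\<^sub>R) \<beta> ` M + (*\<^sub>R) \<alpha> ` K" for \<alpha> \<beta>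
    by (auto simp: set_plus_def) (metis add.commute)+
  define p where "p = vol_poly K M"
  have nz: "K \<noteq> {}" "M \<noteq> {}" using K M by (auto simp: convex_body_def)
  have p_sum: "(\<Sum>j\<le>?n. poly.coeff p j * t ^ j) = vol (M + (*\<^sub>R) t ` K)" if "t \<ge> 0" for t
    using poly_vol_poly[OF K M that] degree_vol_poly[of K M] by (simp add: p_def poly_eq_sum_atMost)
  have "expansion (\<lambda>j. poly.coeff p j / real (?n choose j))"
    unfolding expansion_def set_eq
  proof (intro allI impI)
    fix \<alpha> \<beta> :: real assume nn: "\<alpha> \<ge> 0" "\<beta> \<ge> 0"
    have cancel: "real (?n choose j) * (poly.coeff p j / real (?n choose j)) = poly.coeff p j" if "j \<le> ?n" for j
      using that by simp
    have "vol ((*\<^sub>R) \<beta> ` M + (*\<^sub>R) \<alpha> ` K) = (\<Sum>j\<le>?n. poly.coeff p j * \<alpha> ^ j * \<beta> ^ (?n - j))"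
    proof (cases "\<beta> = 0")
      \<comment> \<open>Dividing by \<open>\<beta>\<close> is impossible here. Since 0^0 = 1 only
        the top term remains, and its coefficient is \<open>vol K\<close> by reversal.\<close>
      case True
      have "(\<Sum>j\<le>?n. poly.coeff p j * \<alpha> ^ j * \<beta> ^ (?n - j)) = (\<Sum>j\<le>?n. if j = ?n then poly.coeff p j * \<alpha> ^ j else 0)"
        using True by (intro sum.cong) auto
      also have "\<dots> = poly.coeff p ?n * \<alpha> ^ ?n" by simp
      also have "poly.coeff p ?n = vol K"
        using coeff_vol_poly_swap[OF K M, of 0] coeff_vol_poly_0[OF M K] by (simp add: p_def)
      finally have "(\<Sum>j\<le>?n. poly.coeff p j * \<alpha> ^ j * \<beta> ^ (?n - j)) = vol ((*\<^sub>R) \<alpha> ` K)"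
        using nn by (simp add: vol_scaleR)
      moreover have "(*\<^sub>R) \<beta> ` M + (*\<^sub>R) \<alpha> ` K = (*\<^sub>R) \<alpha> ` K"
        unfolding True using plus_scaleR_0[OF nz(2), of "(*\<^sub>R) \<alpha> ` K"] by (metis add.commute)
      ultimately show ?thesis by metis
    next
      case False
      then have "(*\<^sub>R) \<beta> ` M + (*\<^sub>R) \<alpha> ` K = (*\<^sub>R) \<beta> ` (M + (*\<^sub>R) (\<alpha> / \<beta>) ` K)"
        by (simp add: scaleR_set_plus scaleR_scaleR_image)
      then have "vol ((*\<^sub>R) \<beta> ` M + (*\<^sub>R) \<alpha> ` K) = \<beta> ^ ?n * (\<Sum>j\<le>?n. poly.coeff p j * (\<alpha> / \<beta>) ^ j)"
        using nn by (simp add: vol_scaleR p_sum)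
      also have "\<dots> = (\<Sum>j\<le>?n. poly.coeff p j * \<alpha> ^ j * \<beta> ^ (?n - j))"
        using False by (auto simp: sum_distrib_left power_divide power_diff intro!: sum.cong)
      finally show ?thesis .
    qed
    moreover have "(\<Sum>j\<le>?n. real (?n choose j) * (poly.coeff p j / real (?n choose j)) * \<alpha> ^ j * \<beta> ^ (?n - j))
        = (\<Sum>j\<le>?n. poly.coeff p j * \<alpha> ^ j * \<beta> ^ (?n - j))"
      by (intro sum.cong refl) (simp only: cancel atMost_iff)
    ultimately show "vol ((*\<^sub>R) \<beta> ` M + (*\<^sub>R) \<alpha> ` K) =
      (\<Sum>j\<le>?n. real (?n choose j) * (poly.coeff p j / real (?n choose j)) * \<alpha> ^ j * \<beta> ^ (?n - j))"
      by simp
  qed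
  then have "expansion (SOME c. expansion c)"
    by (rule someI[of expansion])
  then obtain c where c: "expansion c" "c = (SOME c. expansion c)" by blast
  have "vol_poly K M = (\<Sum>j\<le>?n. monom (real (?n choose j) * c j) j)"
  proof (rule vol_poly_eqI[OF K M])
    fix t :: real assume "t > 0"
    then have "vol ((*\<^sub>R) 1 ` M + (*\<^sub>R) t ` K) = (\<Sum>j\<le>?n. real (?n choose j) * c j * t ^ j)"
      using c(1)[unfolded expansion_def set_eq, rule_format, of t 1] by simp
    then show "poly (\<Sum>j\<le>?n. monom (real (?n choose j) * c j) j) t = vol (M + (*\<^sub>R) t ` K)"
      by (simp add: poly_sum poly_monom)
  qed
  then have "poly.coeff (vol_poly K M) i = real (?n choose i) * c i"
    using i by (simp add: coeff_sum)
  moreover have "mixed_vol K M i = c i"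
    unfolding mixed_vol_def c(2) expansion_def ..
  ultimately show ?thesis
    using i by simp
qed

text \<open>With M_t = M + t L, the increment of the volume splits into the step from M_t to M_t + t
  K and the step from M to M_t. The first is a polynomial in \<open>t\<close> whose coefficients
  depend on M_t, so the point is their convergence as t tends to 0.\<close>

lemma dvol_add:
  fixes K L M :: "'a::euclidean_space set"
  assumes K: "convex_body K" and L: "convex_body L" and M: "convex_body M"
  shows "dvol (K + L) M = dvol K M + dvol L M"
proof -
  let ?n = "DIM('a)"
  let ?M = "\<lambda>t. M + (*\<^sub>R) t ` L"
  have bM: "convex_body (?M t)" for t
    by (intro convex_body_plus convex_body_scaleR M L)
  have coeff_lim: "((\<lambda>t. poly.coeff (vol_poly K (?M t)) i) \<longlongrightarrow> poly.coeff (vol_poly K M) i) (at_right 0)" for i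
  proof -
    \<comment> \<open>Each interpolated value is itself a volume polynomial in \<open>t\<close>, of
      \<open>L\<close> over the body at node \<open>j\<close>, hence continuous at 0.\<close>
    have "((\<lambda>t. vol (?M t + (*\<^sub>R) (real j) ` K)) \<longlongrightarrow> vol (M + (*\<^sub>R) (real j) ` K)) (at_right 0)" for j
    proof -
      let ?p = "vol_poly L (M + (*\<^sub>R) (real j) ` K)"
      have bj: "convex_body (M + (*\<^sub>R) (real j) ` K)"
        by (intro convex_body_plus convex_body_scaleR M K)
      have "(poly ?p \<longlongrightarrow> poly ?p 0) (at_right 0)"
        using poly_isCont[of 0 ?p] by (simp add: isCont_def filterlim_at_split)
      moreover have "poly ?p 0 = vol (M + (*\<^sub>R) (real j) ` K)"
        using coeff_vol_poly_0[OF L bj] by (simp add: poly_0_coeff_0)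
      moreover have "\<forall>\<^sub>F t in at_right 0. poly ?p t = vol (?M t + (*\<^sub>R) (real j) ` K)"
        by (intro eventually_at_right_0) (simp add: poly_vol_poly[OF L bj] add_ac)
      ultimately show ?thesis
        by (rule tendsto_eventually_eqI)
    qed
    then show ?thesis
      unfolding vol_poly_def coeff_sum coeff_smult by (intro tendsto_sum tendsto_mult_right)
  qed
  have "((\<lambda>t. \<Sum>i<?n. poly.coeff (vol_poly K (?M t)) (Suc i) * t ^ i) \<longlongrightarrow>
      (\<Sum>i<?n. poly.coeff (vol_poly K M) (Suc i) * 0 ^ i)) (at_right 0)"
    by (intro tendsto_sum tendsto_mult coeff_lim tendsto_power tendsto_ident_at)
  \<comment> \<open>0^0 = 1 keeps exactly the linear coefficient.\<close>
  also have "(\<Sum>i<?n. poly.coeff (vol_poly K M) (Suc i) * 0 ^ i) = dvol K M"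
  proof -
    obtain m where "?n = Suc m" using DIM_positive by (metis gr0_implies_Suc)
    then show ?thesis by (simp add: sum.lessThan_Suc_shift dvol_def)
  qed
  finally have "((\<lambda>t. (\<Sum>i<?n. poly.coeff (vol_poly K (?M t)) (Suc i) * t ^ i) + (vol (?M t) - vol M) / t)
      \<longlongrightarrow> dvol K M + dvol L M) (at_right 0)"
    using dvol_tendsto[OF L M] by (rule tendsto_add)
  moreover have "\<forall>\<^sub>F t in at_right 0. (\<Sum>i<?n. poly.coeff (vol_poly K (?M t)) (Suc i) * t ^ i) + (vol (?M t) - vol M) / t
      = (vol (M + (*\<^sub>R) t ` (K + L)) - vol M) / t"
  proof (rule eventually_at_right_0)
    fix t :: real assume t: "t > 0"
    let ?p = "vol_poly K (?M t)"
    have "vol (M + (*\<^sub>R) t ` (K + L)) = vol (?M t + (*\<^sub>R) t ` K)"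
      by (simp add: scaleR_set_plus add_ac)
    also have "\<dots> = poly ?p t"
      using t by (simp add: poly_vol_poly[OF K bM])
    also have "\<dots> = (\<Sum>i\<le>?n. poly.coeff ?p i * t ^ i)"
      using degree_vol_poly[of K "?M t"] by (simp add: poly_eq_sum_atMost)
    also have "\<dots> = vol (?M t) + t * (\<Sum>i<?n. poly.coeff ?p (Suc i) * t ^ i)"
      by (simp add: sum.atMost_shift coeff_vol_poly_0[OF K bM] sum_distrib_left mult_ac)
    finally show "(\<Sum>i<?n. poly.coeff ?p (Suc i) * t ^ i) + (vol (?M t) - vol M) / t
      = (vol (M + (*\<^sub>R) t ` (K + L)) - vol M) / t"
      using t by (simp add: field_simps)
  qed
  ultimately have "((\<lambda>t. (vol (M + (*\<^sub>R) t ` (K + L)) - vol M) / t) \<longlongrightarrow> dvol K M + dvol L M) (at_right 0)"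
    by (rule tendsto_eventually_eqI[OF _ refl])
  with dvol_tendsto[OF convex_body_plus[OF K L] M] show ?thesis
    by (intro tendsto_unique[of "at_right (0::real)"]) auto
qed

subsection \<open>Segments\<close>

lemma convex_body_singleton: "convex_body {a}"
  by (simp add: convex_body_def)

lemma convex_body_segment: "convex_body (closed_segment a b)"
  by (simp add: convex_body_def)

lemma convex_body_cball: "r \<ge> 0 \<Longrightarrow> convex_body (cball a r)"
  by (simp add: convex_body_def)

lemma dvol_singleton:
  assumes "convex_body M"
  shows "dvol {a} M = 0"
proof -
  have "dvol {a} M = dvol ((+) a ` (*\<^sub>R) 0 ` {0}) M"
    by simp
  also have "\<dots> = 0 * dvol {0} M"
    unfolding dvol_translation using assms by (intro dvol_scaleR convex_body_singleton) auto
  finally show ?thesis by simp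
qed

lemma dvol_nonneg:
  assumes "convex_body K" "convex_body M"
  shows "dvol K M \<ge> 0"
proof -
  obtain a where "a \<in> K" using assms by (auto simp: convex_body_def)
  then show ?thesis
    using dvol_mono[of "{a}" K M] assms by (simp add: dvol_singleton convex_body_singleton)
qed

lemma scaleR_segment: "(*\<^sub>R) t ` closed_segment 0 u = closed_segment 0 (t *\<^sub>R u)"
  using closed_segment_linear_image[of "(*\<^sub>R) t" 0 u] by simp

lemma mem_plus_segment:
  assumes "t \<ge> 0"
  shows "x \<in> M + closed_segment 0 (t *\<^sub>R u) \<longleftrightarrow> (\<exists>m\<in>M. \<exists>a. 0 \<le> a \<and> a \<le> t \<and> x = m + a *\<^sub>R u)"
proof
  assume "x \<in> M + closed_segment 0 (t *\<^sub>R u)"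
  then obtain m c where "m \<in> M" "0 \<le> c" "c \<le> 1" "x = m + (c * t) *\<^sub>R u"
    by (auto elim!: set_plus_elim simp: in_segment)
  then show "\<exists>m\<in>M. \<exists>a. 0 \<le> a \<and> a \<le> t \<and> x = m + a *\<^sub>R u"
    using assms by (intro bexI[of _ m] exI[of _ "c * t"]) (auto simp: mult_left_le_one_le)
next
  assume "\<exists>m\<in>M. \<exists>a. 0 \<le> a \<and> a \<le> t \<and> x = m + a *\<^sub>R u"
  then obtain m a where *: "m \<in> M" "0 \<le> a" "a \<le> t" "x = m + a *\<^sub>R u" by blast
  have "a *\<^sub>R u \<in> closed_segment 0 (t *\<^sub>R u)"
  proof (cases "t = 0")
    case False
    then show ?thesis
      unfolding in_segment using * assms by (intro exI[of _ "a / t"]) simp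
  qed (use * in simp)
  then show "x \<in> M + closed_segment 0 (t *\<^sub>R u)"
    unfolding *(4) by (rule set_plus_intro[OF *(1)])
qed

text \<open>The long sum is covered by one short sum and a shifted copy of the other; by convexity
  of \<open>M\<close> these overlap exactly in a translate of \<open>M\<close>.\<close>

lemma vol_plus_segment_additive:
  fixes M :: "'a::euclidean_space set"
  assumes M: "convex_body M" and st: "s \<ge> 0" "t \<ge> 0"
  shows "vol (M + closed_segment 0 ((s + t) *\<^sub>R u))
    = vol (M + closed_segment 0 (s *\<^sub>R u)) + vol (M + closed_segment 0 (t *\<^sub>R u)) - vol M"
proof -
  let ?A = "M + closed_segment 0 (s *\<^sub>R u)"
  let ?T = "(+) (s *\<^sub>R u)"
  let ?B = "?T ` (M + closed_segment 0 (t *\<^sub>R u))"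
  have B: "x \<in> ?B \<longleftrightarrow> (\<exists>m\<in>M. \<exists>a. s \<le> a \<and> a \<le> s + t \<and> x = m + a *\<^sub>R u)" for x
  proof
    assume "x \<in> ?B"
    then obtain y where y: "y \<in> M + closed_segment 0 (t *\<^sub>R u)" "x = s *\<^sub>R u + y"
      by (rule imageE)
    obtain m a where "m \<in> M" "0 \<le> a" "a \<le> t" "y = m + a *\<^sub>R u"
      using y(1) unfolding mem_plus_segment[OF st(2)] by (elim bexE exE conjE)
    with y(2) have "m \<in> M" "0 \<le> a" "a \<le> t" "x = s *\<^sub>R u + (m + a *\<^sub>R u)"
      by simp_all
    then show "\<exists>m\<in>M. \<exists>a. s \<le> a \<and> a \<le> s + t \<and> x = m + a *\<^sub>R u"
      by (intro bexI[of _ m] exI[of _ "s + a"]) (auto simp: algebra_simps)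
  next
    assume "\<exists>m\<in>M. \<exists>a. s \<le> a \<and> a \<le> s + t \<and> x = m + a *\<^sub>R u"
    then obtain m a where "m \<in> M" "s \<le> a" "a \<le> s + t" "x = m + a *\<^sub>R u" by blast
    then have "x - s *\<^sub>R u \<in> M + closed_segment 0 (t *\<^sub>R u)"
      unfolding mem_plus_segment[OF st(2)]
      by (intro bexI[of _ m] exI[of _ "a - s"]) (auto simp: algebra_simps)
    then show "x \<in> ?B"
      by (rule rev_image_eqI) simp
  qed
  have un: "M + closed_segment 0 ((s + t) *\<^sub>R u) = ?A \<union> ?B"
  proof (rule set_eqI)
    fix x
    have "x \<in> ?A \<union> ?B \<longleftrightarrow> (\<exists>m\<in>M. \<exists>a. (0 \<le> a \<and> a \<le> s \<or> s \<le> a \<and> a \<le> s + t) \<and> x = m + a *\<^sub>R u)"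
      unfolding Un_iff B mem_plus_segment[OF st(1)] by blast
    also have "\<dots> \<longleftrightarrow> (\<exists>m\<in>M. \<exists>a. 0 \<le> a \<and> a \<le> s + t \<and> x = m + a *\<^sub>R u)"
      using st by (meson add_increasing2 order_trans linear)
    finally show "x \<in> M + closed_segment 0 ((s + t) *\<^sub>R u) \<longleftrightarrow> x \<in> ?A \<union> ?B"
      using mem_plus_segment[of "s + t"] st by simp
  qed
  have int: "?A \<inter> ?B = ?T ` M"
  proof (intro equalityI subsetI)
    fix x assume "x \<in> ?A \<inter> ?B"
    then obtain m a m' b where *: "m \<in> M" "a \<le> s" "x = m + a *\<^sub>R u" "m' \<in> M" "s \<le> b" "x = m' + b *\<^sub>R u"
      unfolding Int_iff B mem_plus_segment[OF st(1)] by (elim conjE bexE exE)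
    have "x - s *\<^sub>R u \<in> closed_segment m m'"
    proof (cases "a = b")
      case True
      then show ?thesis using * by auto
    next
      case False
      \<comment> \<open>Solves a + c (b - a) = s. As \<open>m - m'\<close> is a multiple of
        \<open>u\<close>, this places the shifted point between \<open>m\<close> and
        \<open>m'\<close>.\<close>
      define c where "c = (s - a) / (b - a)"
      have c: "c * (b - a) = s - a" "0 \<le> c" "c \<le> 1"
        using * False by (auto simp: c_def divide_simps)
      have m': "m' = m - (b - a) *\<^sub>R u"
        using *(3,6) by (simp add: algebra_simps)
      have "(1 - c) *\<^sub>R m + c *\<^sub>R m' = m - (c * (b - a)) *\<^sub>R u"
        unfolding m' by (simp add: algebra_simps)
      then have "x - s *\<^sub>R u = (1 - c) *\<^sub>R m + c *\<^sub>R m'"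
        using *(3) by (simp add: c(1) scaleR_diff_left)
      then show ?thesis
        unfolding in_segment using c by blast
    qed
    then have "x - s *\<^sub>R u \<in> M"
      using * M by (meson convex_body_def closed_segment_subset subsetD)
    then show "x \<in> ?T ` M"
      by (rule rev_image_eqI) simp
  next
    fix x assume "x \<in> ?T ` M"
    then obtain m where "m \<in> M" "x = m + s *\<^sub>R u"
      by (auto simp: add.commute)
    then show "x \<in> ?A \<inter> ?B"
      using st unfolding Int_iff B mem_plus_segment[OF st(1)]
      by (intro conjI bexI[of _ m] exI[of _ s]) auto
  qed
  have comp: "compact (M + closed_segment 0 (r *\<^sub>R u))" for r
    using M by (intro compact_set_plus) (auto simp: convex_body_def)
  have "vol (?A \<union> ?B) = vol ?A + vol ?B - vol (?A \<inter> ?B)"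
    by (intro measure_Un3 lmeasurable_compact comp compact_translation)
  then show ?thesis
    by (simp add: un int measure_translation)
qed

text \<open>Additivity makes the volume polynomial affine, so no limit is left; in particular a
  vanishing derivative means that the volume does not grow at all.\<close>

lemma dvol_segment:
  assumes M: "convex_body M"
  shows "dvol (closed_segment 0 u) M = vol (M + closed_segment 0 u) - vol M"
proof -
  let ?p = "vol_poly (closed_segment 0 u) M"
  have p: "poly ?p t = vol (M + closed_segment 0 (t *\<^sub>R u))" if "t \<ge> 0" for t
    using poly_vol_poly[OF convex_body_segment M that, of 0 u] by (simp add: scaleR_segment)
  define d where "d = vol (M + closed_segment 0 u) - vol M"
  have nat: "poly ?p (real k) = vol M + real k * d" for k
  proof (induction k)
    case 0
    show ?case using coeff_vol_poly_0[OF convex_body_segment M, of 0 u] by (simp add: poly_0_coeff_0)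
  next
    case (Suc k)
    have "poly ?p (real (Suc k)) = poly ?p (real k) + d"
      using vol_plus_segment_additive[OF M, of "real k" 1 u] p[of "real k"] p[of "real (Suc k)"]
      by (simp add: d_def add.commute)
    then show ?case
      using Suc by (simp add: algebra_simps)
  qed
  have "?p = [:vol M, d:]"
    by (intro poly_eqI_nat) (simp add: nat)
  then show ?thesis
    by (simp add: dvol_def d_def)
qed

lemma dvol_scaleR_segment:
  assumes "convex_body M" "c \<ge> 0"
  shows "dvol (closed_segment 0 (c *\<^sub>R u)) M = c * dvol (closed_segment 0 u) M"
  using dvol_scaleR[OF convex_body_segment assms, of 0 u] by (simp add: scaleR_segment)

section \<open>Segments against the unit ball\<close>

lemma emeasure_cylinder:
  fixes b :: "'a::euclidean_space"
  assumes b: "b \<in> Basis" and le: "l \<le> u"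
  shows "emeasure lborel {x. l \<le> x \<bullet> b \<and> x \<bullet> b \<le> u \<and> (\<Sum>i\<in>Basis - {b}. (x \<bullet> i)\<^sup>2) \<le> 1}
    = ennreal ((u - l) * unit_ball_vol (real (DIM('a) - 1)))"
proof -
  define A where "A = Basis - {b}"
  define Z where "Z = {x. l \<le> x \<bullet> b \<and> x \<bullet> b \<le> u \<and> (\<Sum>i\<in>A. (x \<bullet> i)\<^sup>2) \<le> 1}"
  have A: "finite A" "b \<notin> A" "Basis = insert b A" "card A = DIM('a) - 1"
    using b by (auto simp: A_def card_Diff_singleton)
  interpret product_sigma_finite "\<lambda>_ :: 'a. lborel :: real measure"
    by standard
  let ?P = "Pi\<^sub>M (insert b A) (\<lambda>_. lborel :: real measure)"
  let ?Q = "Pi\<^sub>M A (\<lambda>_. lborel :: real measure)"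
  let ?Y = "{f. l \<le> f b \<and> f b \<le> u \<and> (\<Sum>i\<in>A. (f i)\<^sup>2) \<le> 1} \<inter> space ?P"
  let ?D = "{f. sqrt (\<Sum>i\<in>A. (f i)\<^sup>2) \<le> 1} \<inter> space ?Q"
  have Z: "Z \<in> sets borel"
    unfolding Z_def by measurable
  have coord: "(\<Sum>i\<in>Basis. f i *\<^sub>R i) \<bullet> j = f j" if "j \<in> Basis" for f :: "'a \<Rightarrow> real" and j
    using that by (simp add: inner_sum_left inner_Basis if_distrib sum.delta cong: if_cong)
  have Y_meas [measurable]: "?Y \<in> sets ?P"
    by measurable
  have "emeasure lborel Z = emeasure (distr (\<Pi>\<^sub>M b\<in>Basis. lborel) borel (\<lambda>f. \<Sum>b\<in>Basis. f b *\<^sub>R b)) Z"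
    by (subst lborel_eq) simp
  also have "\<dots> = emeasure ?P ((\<lambda>f. \<Sum>b\<in>Basis. f b *\<^sub>R b) -` Z \<inter> space ?P)"
    using Z unfolding A(3)[symmetric] by (intro emeasure_distr) auto
  also have "(\<lambda>f. \<Sum>b\<in>Basis. f b *\<^sub>R b) -` Z = {f. l \<le> f b \<and> f b \<le> u \<and> (\<Sum>i\<in>A. (f i)\<^sup>2) \<le> 1}"
    using b by (auto simp: Z_def coord A_def)
  also have "emeasure ?P ?Y = nn_integral ?P (indicator ?Y)"
    by (subst nn_integral_indicator) auto
  also have "\<dots> = (\<integral>\<^sup>+ y. \<integral>\<^sup>+ f. indicator ?Y (f(b := y)) \<partial>?Q \<partial>lborel)"
    using A(1,2) by (intro product_nn_integral_insert_rev borel_measurable_indicator Y_meas)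
  \<comment> \<open>The condition on the coordinate \<open>b\<close> separates from the ball
    condition on the others.\<close>
  also have "\<dots> = (\<integral>\<^sup>+ y. \<integral>\<^sup>+ f. indicator {l..u} y * indicator ?D f \<partial>?Q \<partial>lborel)"
  proof (intro nn_integral_cong)
    fix y :: real and f assume f: "f \<in> space ?Q"
    have "(\<Sum>i\<in>A. ((f(b := y)) i)\<^sup>2) = (\<Sum>i\<in>A. (f i)\<^sup>2)"
      using A by (intro sum.cong) auto
    moreover have "f(b := y) \<in> space ?P"
      using f by (auto simp: space_PiM PiE_def extensional_def)
    ultimately show "indicator ?Y (f(b := y)) = (indicator {l..u} y * indicator ?D f :: ennreal)"
      using f by (auto simp: indicator_def)
  qed
  also have "\<dots> = (\<integral>\<^sup>+ y. indicator {l..u} y * (\<integral>\<^sup>+ f. indicator ?D f \<partial>?Q) \<partial>lborel)"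
    by (subst nn_integral_cmult) auto
  also have "(\<integral>\<^sup>+ f. indicator ?D f \<partial>?Q) = emeasure ?Q ?D"
    using A by (subst nn_integral_indicator) auto
  also have "emeasure ?Q ?D = ennreal (unit_ball_vol (real (DIM('a) - 1)))"
    using emeasure_cball_aux[OF A(1), of 1] A(4) by simp
  also have "(\<integral>\<^sup>+ y. indicator {l..u} y * ennreal (unit_ball_vol (real (DIM('a) - 1))) \<partial>lborel)
      = emeasure lborel {l..u} * ennreal (unit_ball_vol (real (DIM('a) - 1)))"
    by (subst nn_integral_multc) auto
  also have "\<dots> = ennreal ((u - l) * unit_ball_vol (real (DIM('a) - 1)))"
    using le by (simp add: ennreal_mult)
  finally show ?thesis
    by (simp add: Z_def A_def)
qed

lemma norm_orthogonal_part_le_1: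
  assumes "b \<in> Basis"
  shows "norm (x - (x \<bullet> b) *\<^sub>R b) \<le> 1 \<longleftrightarrow> (\<Sum>i\<in>Basis - {b}. (x \<bullet> i)\<^sup>2) \<le> 1"
proof -
  have "(norm (x - (x \<bullet> b) *\<^sub>R b))\<^sup>2 = (\<Sum>i\<in>Basis. (x \<bullet> i - (x \<bullet> b) * (b \<bullet> i))\<^sup>2)"
    by (subst power2_norm_eq_inner, subst euclidean_inner) (simp add: inner_diff_left power2_eq_square)
  also have "\<dots> = (\<Sum>i\<in>Basis - {b}. (x \<bullet> i)\<^sup>2)"
    using assms by (subst sum.remove[of _ b]) (auto simp: inner_Basis intro!: sum.cong split: if_splits)
  finally show ?thesis
    by (metis abs_norm_cancel one_power2 power2_le_iff_abs_le zero_le_one)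
qed

text \<open>The sum of the ball and [0, t b] contains a cylinder of height t over the (n-1)-ball and
  lies in one of height t + 2, while its volume is affine in t. Comparing for large t identifies the
  slope.\<close>

lemma dvol_segment_Basis_ball:
  fixes b :: "'a::euclidean_space"
  assumes b: "b \<in> Basis"
  shows "dvol (closed_segment 0 b) (cball 0 1) = unit_ball_vol (real (DIM('a) - 1))"
proof -
  let ?k = "unit_ball_vol (real (DIM('a) - 1))"
  let ?d = "dvol (closed_segment 0 b) (cball 0 1)"
  define Z where "Z = (\<lambda>l u. {x. l \<le> x \<bullet> b \<and> x \<bullet> b \<le> u \<and> norm (x - (x \<bullet> b) *\<^sub>R b) \<le> 1})"
  have nb [simp]: "norm b = 1" "b \<bullet> b = 1" using b by (auto simp: inner_Basis)
  have em: "emeasure lborel (Z l u) = ennreal ((u - l) * ?k)" if "l \<le> u" for l u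
    using emeasure_cylinder[OF b that] by (simp add: Z_def norm_orthogonal_part_le_1[OF b])
  have Zb: "Z l u \<in> sets borel" for l u
    unfolding Z_def by measurable
  have volZ: "vol (Z l u) = (u - l) * ?k" "Z l u \<in> lmeasurable" if "l \<le> u" for l u
    using em[OF that] Zb[of l u] that by (auto simp: measure_def fmeasurable_def)
  define C where "C = (\<lambda>t. cball 0 1 + closed_segment 0 (t *\<^sub>R b))"
  have Cm: "C t \<in> lmeasurable" for t
    unfolding C_def by (intro lmeasurable_compact compact_set_plus) auto
  have Cvol: "vol (C t) = vol (cball 0 1 :: 'a set) + t * ?d" if "t \<ge> 0" for t
    using dvol_segment[OF convex_body_cball[of 1 0], of "t *\<^sub>R b"]
      dvol_scaleR_segment[OF convex_body_cball[of 1 0] that, of b]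
    by (simp add: C_def)
  have lower: "t * ?k \<le> vol (C t)" if t: "t \<ge> 0" for t
  proof -
    have "Z 0 t \<subseteq> C t"
    proof
      fix x assume "x \<in> Z 0 t"
      then show "x \<in> C t"
        unfolding C_def mem_plus_segment[OF t]
        by (intro bexI[of _ "x - (x \<bullet> b) *\<^sub>R b"] exI[of _ "x \<bullet> b"]) (auto simp: Z_def)
    qed
    then have "vol (Z 0 t) \<le> vol (C t)"
      using volZ(2)[OF t] Cm by (intro measure_mono_fmeasurable) (auto simp: fmeasurableD)
    then show ?thesis using volZ[OF t] by simp
  qed
  have upper: "vol (C t) \<le> (t + 2) * ?k" if t: "t \<ge> 0" for t
  proof -
    have "C t \<subseteq> Z (-1) (t + 1)"
    proof
      fix x assume "x \<in> C t"
      then obtain m a where m: "norm m \<le> 1" "0 \<le> a" "a \<le> t" "x = m + a *\<^sub>R b"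
        unfolding C_def mem_plus_segment[OF t] by auto
      have "\<bar>m \<bullet> b\<bar> \<le> 1"
        using Cauchy_Schwarz_ineq2[of m b] m by simp
      moreover have "x - (x \<bullet> b) *\<^sub>R b = m - (m \<bullet> b) *\<^sub>R b"
        by (simp add: m inner_add_left algebra_simps)
      moreover have "(norm (m - (m \<bullet> b) *\<^sub>R b))\<^sup>2 \<le> (norm m)\<^sup>2"
        by (simp add: power2_norm_eq_inner inner_diff_left inner_diff_right inner_commute)
      then have "norm (m - (m \<bullet> b) *\<^sub>R b) \<le> 1"
        using m(1) by (meson norm_ge_zero order_trans power2_le_imp_le)
      moreover have "x \<bullet> b = m \<bullet> b + a"
        by (simp add: m inner_add_left)
      ultimately show "x \<in> Z (-1) (t + 1)"
        using m(2,3) by (auto simp: Z_def)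
    qed
    then have "vol (C t) \<le> vol (Z (-1) (t + 1))"
      using volZ(2)[of "-1" "t + 1"] Cm t by (intro measure_mono_fmeasurable) (auto simp: fmeasurableD)
    then show ?thesis using volZ[of "-1" "t + 1"] t by (simp add: algebra_simps)
  qed
  have bound: "t * \<bar>?d - ?k\<bar> \<le> vol (cball 0 1 :: 'a set) + 2 * ?k" if t: "t \<ge> 0" for t
    using lower[OF t] upper[OF t] Cvol[OF t] t unit_ball_vol_nonneg[of "real (DIM('a) - 1)"]
    by (auto simp: abs_if algebra_simps intro: add_nonneg_nonneg) (smt (verit) measure_nonneg)+
  have "\<bar>?d - ?k\<bar> = 0"
  proof (rule ccontr)
    assume "\<bar>?d - ?k\<bar> \<noteq> 0"
    then have pos: "\<bar>?d - ?k\<bar> > 0" by simp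
    then obtain k :: nat where "vol (cball 0 1 :: 'a set) + 2 * ?k < real k * \<bar>?d - ?k\<bar>"
      using reals_Archimedean3 by blast
    then show False using bound[of "real k"] by simp
  qed
  then show ?thesis by simp
qed

lemma orthogonal_transformation_unit_vectors:
  fixes a b :: "'a::euclidean_space"
  assumes "norm a = 1" "norm b = 1"
  obtains f where "orthogonal_transformation f" "f a = b"
proof -
  have norm_to_cart: "norm (to_cart x) = norm x" for x :: 'a
    by (simp add: norm_eq_sqrt_inner)
  obtain g where g: "orthogonal_transformation g" "g (to_cart a) = to_cart b"
    using orthogonal_transformation_exists_1[of "to_cart a" "to_cart b"] assms
    by (auto simp: norm_to_cart)
  have inner_of_cart: "of_cart v \<bullet> of_cart w = v \<bullet> w" for v w
    using inner_to_cart[of "of_cart v" "of_cart w"] by simp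
  have "orthogonal_transformation (of_cart \<circ> g \<circ> to_cart)"
    using g(1) unfolding orthogonal_transformation_def
    by (simp add: inner_of_cart linear_compose linear_of_cart linear_to_cart)
  moreover have "(of_cart \<circ> g \<circ> to_cart) a = b"
    by (simp add: g)
  ultimately show ?thesis using that by blast
qed

lemma dvol_segment_ball:
  fixes u :: "'a::euclidean_space"
  shows "dvol (closed_segment 0 u) (cball 0 1) = norm u * unit_ball_vol (real (DIM('a) - 1))"
proof (cases "u = 0")
  case True
  then show ?thesis by (simp add: dvol_singleton convex_body_cball)
next
  case False
  obtain b :: 'a where b: "b \<in> Basis" using nonempty_Basis by blast
  have "norm b = 1" "norm (u /\<^sub>R norm u) = 1" using b False by auto
  then obtain f where f: "orthogonal_transformation f" "f b = u /\<^sub>R norm u"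
    using orthogonal_transformation_unit_vectors by blast
  have lf: "linear f" using f(1) by (rule orthogonal_transformation_linear)
  have "f ` cball 0 1 = cball 0 1"
    using image_orthogonal_transformation_cball[OF f(1), of 0 1] lf by (simp add: linear_0)
  moreover have "f ` closed_segment 0 b = closed_segment 0 (u /\<^sub>R norm u)"
    using closed_segment_linear_image[OF lf, of 0 b] lf f(2) by (simp add: linear_0)
  ultimately have "dvol (closed_segment 0 (u /\<^sub>R norm u)) (cball 0 1) = unit_ball_vol (real (DIM('a) - 1))"
    using dvol_orthogonal_image[OF f(1) convex_body_segment convex_body_cball, of 1 0 b 0]
      dvol_segment_Basis_ball[OF b] by simp
  then show ?thesis
    using dvol_scaleR_segment[of "cball 0 1" "norm u" "u /\<^sub>R norm u"] False
    by (simp add: convex_body_cball)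
qed

subsection \<open>The circumscribed ball\<close>

text \<open>Optimality certificate of a circumscribed ball: its centre is a convex combination of
  points on its sphere. The body itself does not occur; \<open>circumball_exists\<close> links the
  two.\<close>

locale contact_points =
  fixes T :: "'a::euclidean_space set" and l :: "'a \<Rightarrow> real" and c :: 'a and R :: real
  assumes finite_T: "finite T" and l_pos: "k \<in> T \<Longrightarrow> l k > 0" and sum_l: "sum l T = 1"
    and centre: "(\<Sum>k\<in>T. l k *\<^sub>R k) = c" and radius: "k \<in> T \<Longrightarrow> norm (k - c) = R"

text \<open>Maximising the concave function \<open>s - |x|\<^sup>2\<close> over the convex hull of the lifted set
  \<open>{(k, |k|\<^sup>2)}\<close> yields the centre together with a convex representation by contact points.\<close>

lemma circumball_exists:
  fixes K :: "'a::euclidean_space set"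
  assumes K: "compact K" "K \<noteq> {}"
  obtains R c T l where "R \<ge> 0" "K \<subseteq> cball c R" "T \<subseteq> K" "contact_points T l c R"
proof -
  define \<phi> where "\<phi> = (\<lambda>k::'a. (k, k \<bullet> k))"
  define H where "H = convex hull (\<phi> ` K)"
  have "compact (\<phi> ` K)"
    unfolding \<phi>_def by (intro compact_continuous_image continuous_intros K)
  then have "compact H" "H \<noteq> {}"
    using K by (auto simp: H_def compact_convex_hull)
  moreover have "continuous_on H (\<lambda>p. snd p - fst p \<bullet> fst p)"
    by (intro continuous_intros)
  ultimately obtain p where p: "p \<in> H" "\<And>q. q \<in> H \<Longrightarrow> snd q - fst q \<bullet> fst q \<le> snd p - fst p \<bullet> fst p"
    using continuous_attains_sup[of H "\<lambda>p. snd p - fst p \<bullet> fst p"] by metis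
  define c where "c = fst p"
  define s where "s = snd p"
  have p_eq: "p = (c, s)" by (simp add: c_def s_def)
  \<comment> \<open>First variation of the maximised function from \<open>p\<close> towards
    \<open>\<phi> k\<close>; rewritten, it says that \<open>k\<close> lies in the ball to be
    constructed.\<close>
  have first_order: "k \<bullet> k - s - 2 * (c \<bullet> (k - c)) \<le> 0" if k: "k \<in> K" for k
  proof (rule ccontr)
    assume neg: "\<not> ?thesis"
    define d where "d = k \<bullet> k - s - 2 * (c \<bullet> (k - c))"
    define N where "N = (k - c) \<bullet> (k - c)"
    have d: "d > 0" using neg by (simp add: d_def)
    have N: "N \<ge> 0" by (simp add: N_def)
    \<comment> \<open>Small enough that \<open>t * N\<close> stays below \<open>d\<close>, so the
      first-order gain beats the quadratic loss, and at most 1 for convexity.\<close>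
    define t where "t = d / (d + N + 1)"
    have t: "0 < t" "t \<le> 1" using d N by (auto simp: t_def)
    have "t * N < d"
      using d N mult_strict_left_mono[of N "d + N + 1" d] by (simp add: t_def divide_less_eq)
    have "(1 - t) *\<^sub>R p + t *\<^sub>R \<phi> k \<in> H"
      using p(1) k t convex_convex_hull[of "\<phi> ` K"] unfolding H_def
      by (intro convexD) (auto intro: hull_inc)
    from p(2)[OF this] have "(1 - t) * s + t * (k \<bullet> k) - ((1 - t) *\<^sub>R c + t *\<^sub>R k) \<bullet> ((1 - t) *\<^sub>R c + t *\<^sub>R k) \<le> s - c \<bullet> c"
      by (simp add: p_eq \<phi>_def)
    also have "(1 - t) *\<^sub>R c + t *\<^sub>R k = c + t *\<^sub>R (k - c)"
      by (simp add: algebra_simps)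
    also have "(c + t *\<^sub>R (k - c)) \<bullet> (c + t *\<^sub>R (k - c)) = c \<bullet> c + 2 * t * (c \<bullet> (k - c)) + t * t * N"
      by (simp add: N_def inner_add_left inner_add_right inner_commute algebra_simps)
    finally have "t * d \<le> t * (t * N)"
      by (simp add: d_def algebra_simps)
    then show False
      using t \<open>t * N < d\<close> by simp
  qed
  have norm_sq: "(norm (k - c))\<^sup>2 = k \<bullet> k - 2 * (c \<bullet> k) + c \<bullet> c" for k
    by (simp add: power2_norm_eq_inner inner_diff_left inner_diff_right inner_commute)
  have dist_le: "(norm (k - c))\<^sup>2 \<le> s - c \<bullet> c" if "k \<in> K" for k
    using first_order[OF that] by (simp add: norm_sq inner_diff_right)
  have "s - c \<bullet> c \<ge> 0"
    using dist_le K(2) by (meson all_not_in_conv order_trans zero_le_power2)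
  define R where "R = sqrt (s - c \<bullet> c)"
  have R: "R \<ge> 0" "R\<^sup>2 = s - c \<bullet> c"
    using \<open>s - c \<bullet> c \<ge> 0\<close> by (auto simp: R_def)
  obtain F u where F: "finite F" "F \<subseteq> \<phi> ` K" "\<And>x. x \<in> F \<Longrightarrow> u x \<ge> 0" "sum u F = 1" "(\<Sum>v\<in>F. u v *\<^sub>R v) = (c, s)"
    using p(1) unfolding H_def convex_hull_explicit p_eq by blast
  define T0 where "T0 = {k \<in> K. \<phi> k \<in> F}"
  define l where "l = (\<lambda>k. u (\<phi> k))"
  \<comment> \<open>Points of weight zero are discarded, since contact with the sphere is only
    forced for positive weight.\<close>
  define T where "T = {k \<in> T0. l k > 0}"
  have inj: "inj_on \<phi> A" for A by (auto simp: \<phi>_def inj_on_def)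
  have F_eq: "F = \<phi> ` T0" using F(2) by (auto simp: T0_def)
  have T0: "finite T0" using F(1) F_eq inj by (metis finite_imageD)
  have T: "finite T" "T \<subseteq> T0" using T0 by (auto simp: T_def)
  have l0: "l k = 0" if "k \<in> T0 - T" for k
    using that F(3)[of "\<phi> k"] F_eq by (force simp: T_def l_def)
  have "sum l T0 = 1"
    using F(4) by (simp add: F_eq sum.reindex inj l_def o_def)
  then have suml: "sum l T = 1"
    using sum.mono_neutral_left[OF T0 T(2), of l] l0 by simp
  have "(\<Sum>k\<in>T0. l k *\<^sub>R \<phi> k) = (c, s)"
    using F(5) by (simp add: F_eq sum.reindex inj l_def o_def)
  moreover have "(\<Sum>k\<in>T. l k *\<^sub>R \<phi> k) = (\<Sum>k\<in>T0. l k *\<^sub>R \<phi> k)"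
    using l0 by (intro sum.mono_neutral_left T0 T) auto
  ultimately have "(\<Sum>k\<in>T. l k *\<^sub>R \<phi> k) = (c, s)" by simp
  then have sumk: "(\<Sum>k\<in>T. l k *\<^sub>R k) = c" and sumkk: "(\<Sum>k\<in>T. l k * (k \<bullet> k)) = s"
    by (auto simp: \<phi>_def sum_prod prod_eq_iff fst_sum snd_sum)
  \<comment> \<open>The slacks are nonnegative and their weighted sum turns out to be zero, so every
    retained point is on the sphere.\<close>
  have "(\<Sum>k\<in>T. l k * (R\<^sup>2 - (norm (k - c))\<^sup>2))
      = (R\<^sup>2 - c \<bullet> c) * sum l T - (\<Sum>k\<in>T. l k * (k \<bullet> k)) + 2 * (c \<bullet> (\<Sum>k\<in>T. l k *\<^sub>R k))"
    unfolding sum_distrib_left inner_sum_right sum_subtractf[symmetric] sum.distrib[symmetric]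
    by (intro sum.cong) (auto simp: norm_sq algebra_simps)
  also have "\<dots> = 0"
    by (simp add: suml sumk sumkk R(2))
  finally have zero: "(\<Sum>k\<in>T. l k * (R\<^sup>2 - (norm (k - c))\<^sup>2)) = 0" .
  have TK: "T \<subseteq> K" by (auto simp: T_def T0_def)
  have lpos: "l k > 0" if "k \<in> T" for k using that by (simp add: T_def)
  have "norm (k - c) = R" if k: "k \<in> T" for k
  proof -
    have "l k * (R\<^sup>2 - (norm (k - c))\<^sup>2) = 0"
      using zero k lpos dist_le TK R(2) T(1)
      by (subst (asm) sum_nonneg_eq_0_iff) (auto intro!: mult_nonneg_nonneg simp: less_imp_le subset_iff)
    then have "(norm (k - c))\<^sup>2 = R\<^sup>2"
      using lpos[OF k] by simp
    then show ?thesis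
      using R(1) by (simp add: power2_eq_iff_nonneg)
  qed
  moreover have "K \<subseteq> cball c R"
  proof
    fix k assume "k \<in> K"
    then have "(norm (k - c))\<^sup>2 \<le> R\<^sup>2" using dist_le R(2) by simp
    then have "norm (k - c) \<le> R" using R(1) by (rule power2_le_imp_le)
    then show "k \<in> cball c R" by (simp add: dist_norm norm_minus_commute)
  qed
  ultimately show ?thesis
    using R(1) T(1) TK lpos suml sumk by (intro that[of R c T l] contact_points.intro) auto
qed

lemma convex_body_sum:
  assumes "finite T" "\<And>k. k \<in> T \<Longrightarrow> convex_body (S k :: 'a::euclidean_space set)"
  shows "convex_body (\<Sum>k\<in>T. S k)"
  using assms
proof (induction T)
  case empty
  then show ?case by (simp add: set_zero convex_body_singleton)
next
  case (insert k T)
  then show ?case by (simp add: convex_body_plus)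
qed

lemma dvol_sum:
  assumes "finite T" "\<And>k. k \<in> T \<Longrightarrow> convex_body (S k :: 'a::euclidean_space set)" "convex_body M"
  shows "dvol (\<Sum>k\<in>T. S k) M = (\<Sum>k\<in>T. dvol (S k) M)"
  using assms
proof (induction T)
  case empty
  then show ?case by (simp add: set_zero dvol_singleton)
next
  case (insert k T)
  then show ?case by (simp add: dvol_add convex_body_sum)
qed

context contact_points
begin

text \<open>The factor 4 compensates the maximum 1/4 of \<theta> (1 - \<theta>) in
  \<open>zonotope_decompose\<close>; the generators then have total length 4 R.\<close>

definition zonotope :: "'a set" where
  "zonotope = (\<Sum>k\<in>T. closed_segment 0 ((4 * l k) *\<^sub>R (k - c)))"

lemma convex_body_zonotope: "convex_body zonotope"
  unfolding zonotope_def by (intro convex_body_sum finite_T convex_body_segment)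

lemma dvol_zonotope: "dvol zonotope (cball 0 1) = 4 * R * unit_ball_vol (real (DIM('a) - 1))"
proof -
  have "dvol zonotope (cball 0 1) = (\<Sum>k\<in>T. dvol (closed_segment 0 ((4 * l k) *\<^sub>R (k - c))) (cball 0 1))"
    unfolding zonotope_def by (intro dvol_sum finite_T convex_body_segment convex_body_cball) simp
  also have "\<dots> = (\<Sum>k\<in>T. l k * (4 * R * unit_ball_vol (real (DIM('a) - 1))))"
    by (intro sum.cong) (use l_pos radius in \<open>auto simp: dvol_segment_ball abs_of_pos\<close>)
  also have "\<dots> = 4 * R * unit_ball_vol (real (DIM('a) - 1))"
    by (simp add: sum_distrib_right[symmetric] sum_l)
  finally show ?thesis .
qed

lemma sum_contact_zero: "(\<Sum>k\<in>T. l k *\<^sub>R (k - c)) = 0"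
  by (simp add: scaleR_diff_right sum_subtractf centre scaleR_sum_left[symmetric] sum_l)

lemma centre_in_hull: "c \<in> convex hull T"
  using centre[symmetric] finite_T l_pos sum_l
  by (auto intro!: convex_sum simp: hull_inc less_imp_le)

text \<open>Take a fraction \<open>\<tau> k\<close> of each generator. Splitting every weight
  \<open>l k\<close> into \<open>l k * \<tau> k\<close> and the rest gives barycentres
  \<open>p\<close> and \<open>q\<close> of total weights \<theta> and 1 - \<theta>, balanced about
  \<open>c\<close> because the weighted sum of \<open>k - c\<close> is zero. The balance equation
  serves the equality case.\<close>

lemma zonotope_decompose:
  assumes "z \<in> zonotope"
  obtains p q \<theta> where "p \<in> convex hull T" "q \<in> convex hull T" "0 \<le> \<theta>" "\<theta> \<le> 1"
    "z = (4 * \<theta> * (1 - \<theta>)) *\<^sub>R (p - q)" "\<theta> *\<^sub>R (p - c) + (1 - \<theta>) *\<^sub>R (q - c) = 0"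
proof -
  have "z \<in> {sum s T | s. \<forall>k\<in>T. s k \<in> closed_segment 0 ((4 * l k) *\<^sub>R (k - c))}"
    using assms unfolding zonotope_def by (simp add: set_sum_alt finite_T)
  then obtain s where s: "z = sum s T" "\<forall>k\<in>T. s k \<in> closed_segment 0 ((4 * l k) *\<^sub>R (k - c))"
    by blast
  have "\<forall>k\<in>T. \<exists>\<tau>. 0 \<le> \<tau> \<and> \<tau> \<le> 1 \<and> s k = \<tau> *\<^sub>R ((4 * l k) *\<^sub>R (k - c))"
    using s(2) by (auto simp: in_segment)
  then obtain \<tau> where \<tau>: "\<And>k. k \<in> T \<Longrightarrow> 0 \<le> \<tau> k \<and> \<tau> k \<le> 1 \<and> s k = \<tau> k *\<^sub>R ((4 * l k) *\<^sub>R (k - c))"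
    by metis
  define \<theta> where "\<theta> = (\<Sum>k\<in>T. l k * \<tau> k)"
  define y where "y = (\<Sum>k\<in>T. (l k * \<tau> k) *\<^sub>R (k - c))"
  have z: "z = 4 *\<^sub>R y"
    unfolding s(1) y_def scaleR_sum_right using \<tau> by (intro sum.cong) (auto simp: mult_ac)
  have nn: "0 \<le> l k * \<tau> k" "0 \<le> l k * (1 - \<tau> k)" if "k \<in> T" for k
    using \<tau>[OF that] l_pos[OF that] by auto
  have compl: "(\<Sum>k\<in>T. l k * (1 - \<tau> k)) = 1 - \<theta>"
    by (simp add: \<theta>_def algebra_simps sum_subtractf sum_l)
  have \<theta>: "0 \<le> \<theta>" "\<theta> \<le> 1"
    using nn sum_nonneg[of T "\<lambda>k. l k * \<tau> k"] sum_nonneg[of T "\<lambda>k. l k * (1 - \<tau> k)"] compl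
    by (auto simp: \<theta>_def)
  have y': "(\<Sum>k\<in>T. (l k * (1 - \<tau> k)) *\<^sub>R (k - c)) = - y"
  proof -
    have "(\<Sum>k\<in>T. (l k * (1 - \<tau> k)) *\<^sub>R (k - c)) = (\<Sum>k\<in>T. l k *\<^sub>R (k - c)) - y"
      unfolding y_def sum_subtractf[symmetric] by (intro sum.cong) (auto simp: algebra_simps)
    then show ?thesis by (simp add: sum_contact_zero)
  qed
  show ?thesis
  proof (cases "\<theta> = 0 \<or> \<theta> = 1")
    \<comment> \<open>One of the two families of weights vanishes, so z = 0 and p = q = c
      serves.\<close>
    case True
    have "y = 0"
    proof (cases "\<theta> = 0")
      case True
      then have "\<forall>k\<in>T. l k * \<tau> k = 0"
        using nn finite_T unfolding \<theta>_def by (subst (asm) sum_nonneg_eq_0_iff) auto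
      then show ?thesis by (auto simp: y_def intro!: sum.neutral)
    next
      case False
      then have "(\<Sum>k\<in>T. l k * (1 - \<tau> k)) = 0" using True compl by simp
      then have "\<forall>k\<in>T. l k * (1 - \<tau> k) = 0"
        using nn finite_T by (subst (asm) sum_nonneg_eq_0_iff) auto
      then have "- y = 0" unfolding y'[symmetric] by (intro sum.neutral) auto
      then show ?thesis by simp
    qed
    then show ?thesis
      using that[of c c \<theta>] centre_in_hull \<theta> z by simp
  next
    case False
    then have pos: "\<theta> > 0" "1 - \<theta> > 0" using \<theta> by auto
    define p where "p = (\<Sum>k\<in>T. (l k * \<tau> k / \<theta>) *\<^sub>R k)"
    define q where "q = (\<Sum>k\<in>T. (l k * (1 - \<tau> k) / (1 - \<theta>)) *\<^sub>R k)"
    have p1: "(\<Sum>k\<in>T. l k * \<tau> k / \<theta>) = 1" and q1: "(\<Sum>k\<in>T. l k * (1 - \<tau> k) / (1 - \<theta>)) = 1"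
      using pos by (simp_all add: sum_divide_distrib[symmetric] compl) (simp add: \<theta>_def[symmetric])
    have mem: "p \<in> convex hull T" "q \<in> convex hull T"
      unfolding p_def q_def using nn pos p1 q1 finite_T by (auto intro!: convex_sum simp: hull_inc)
    have p_c: "\<theta> *\<^sub>R (p - c) = y"
    proof -
      have "p - c = (\<Sum>k\<in>T. (l k * \<tau> k / \<theta>) *\<^sub>R (k - c))"
        by (simp add: p_def scaleR_diff_right sum_subtractf scaleR_sum_left[symmetric] p1)
      then show ?thesis
        using pos by (simp add: y_def scaleR_sum_right)
    qed
    have q_c: "(1 - \<theta>) *\<^sub>R (q - c) = - y"
    proof -
      have "q - c = (\<Sum>k\<in>T. (l k * (1 - \<tau> k) / (1 - \<theta>)) *\<^sub>R (k - c))"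
        by (simp add: q_def scaleR_diff_right sum_subtractf scaleR_sum_left[symmetric] q1)
      then show ?thesis
        using pos by (simp add: y'[symmetric] scaleR_sum_right)
    qed
    have "(\<theta> * (1 - \<theta>)) *\<^sub>R (p - q) = (1 - \<theta>) *\<^sub>R (\<theta> *\<^sub>R (p - c)) - \<theta> *\<^sub>R ((1 - \<theta>) *\<^sub>R (q - c))"
      by (simp add: algebra_simps)
    also have "\<dots> = y"
      unfolding p_c q_c by (simp add: algebra_simps)
    finally have "z = (4 * \<theta> * (1 - \<theta>)) *\<^sub>R (p - q)"
      unfolding z by (metis mult.assoc scaleR_scaleR)
    then show ?thesis
      using that[OF mem \<theta>] p_c q_c by simp
  qed
qed

text \<open>Since 4 \<theta> (1 - \<theta>) = 1 - (2 \<theta> - 1)^2 \<le> 1, shrinking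
  \<open>p - q\<close> amounts to moving \<open>p\<close> towards \<open>q\<close> inside
  \<open>K\<close>.\<close>

lemma zonotope_subset:
  assumes K: "convex_body K" and TK: "T \<subseteq> K"
  shows "zonotope \<subseteq> K + uminus ` K"
proof
  fix z assume "z \<in> zonotope"
  then obtain p q \<theta> where *: "p \<in> convex hull T" "q \<in> convex hull T" "0 \<le> \<theta>" "\<theta> \<le> 1"
    "z = (4 * \<theta> * (1 - \<theta>)) *\<^sub>R (p - q)"
    by (rule zonotope_decompose)
  define a where "a = 4 * \<theta> * (1 - \<theta>)"
  have a0: "0 \<le> a"
    using *(3,4) by (simp add: a_def)
  have "a = 1 - (2 * \<theta> - 1)\<^sup>2"
    by (simp add: a_def power2_eq_square algebra_simps)
  with a0 have a: "0 \<le> a" "a \<le> 1" by simp_all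
  have "convex K" using K by (simp add: convex_body_def)
  then have pq: "p \<in> K" "q \<in> K" using * TK by (auto dest: hull_minimal[of T K convex])
  then have "a *\<^sub>R p + (1 - a) *\<^sub>R q \<in> K"
    using a \<open>convex K\<close> by (intro convexD) auto
  then have "(a *\<^sub>R p + (1 - a) *\<^sub>R q) + (- q) \<in> K + uminus ` K"
    using pq by (intro set_plus_intro) auto
  moreover have "(a *\<^sub>R p + (1 - a) *\<^sub>R q) + (- q) = z"
    unfolding *(5) a_def[symmetric] by (simp add: algebra_simps)
  ultimately show "z \<in> K + uminus ` K" by simp
qed

end

section \<open>The two circumradius bounds and the inequality\<close>

lemma convex_body_uminus: "convex_body K \<Longrightarrow> convex_body (uminus ` (K :: 'a::euclidean_space set))"
  by (rule convex_body_linear_image) (simp_all add: linear_uminus)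

lemma dvol_uminus_ball:
  fixes K :: "'a::euclidean_space set"
  assumes "convex_body K"
  shows "dvol (uminus ` K) (cball 0 1) = dvol K (cball 0 1)"
proof -
  have orth: "orthogonal_transformation (uminus :: 'a \<Rightarrow> 'a)"
    by (simp add: orthogonal_transformation_def linear_uminus)
  have "uminus ` cball 0 1 = (cball 0 1 :: 'a set)"
    using image_orthogonal_transformation_cball[OF orth, of 0 1] by simp
  then show ?thesis
    using dvol_orthogonal_image[OF orth, of K "cball 0 1"] assms by (simp add: convex_body_cball)
qed

text \<open>Generators of total length 4 R against D(K - K, B) = 2 D(K, B); the reflection of
  \<open>K\<close> counts like \<open>K\<close> because the ball is symmetric.\<close>

lemma (in contact_points) dvol_ball_ge_circumradius:
  assumes K: "convex_body K" and TK: "T \<subseteq> K"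
  shows "dvol K (cball 0 1) \<ge> 2 * R * unit_ball_vol (real (DIM('a) - 1))"
proof -
  have "dvol zonotope (cball 0 1) \<le> dvol (K + uminus ` K) (cball 0 1)"
    by (intro dvol_mono convex_body_zonotope convex_body_plus convex_body_uminus K convex_body_cball
        zonotope_subset TK) simp
  also have "\<dots> = 2 * dvol K (cball 0 1)"
    using dvol_add[OF K convex_body_uminus[OF K] convex_body_cball[of 1 0]] dvol_uminus_ball[OF K] by simp
  finally show ?thesis by (simp add: dvol_zonotope)
qed

lemma dvol_cball:
  fixes M :: "'a::euclidean_space set"
  assumes "convex_body M" "R \<ge> 0"
  shows "dvol (cball c R) M = R * dvol (cball 0 1) M"
proof -
  have "cball c R = (+) c ` (*\<^sub>R) R ` cball 0 1"
  proof (cases "R = 0")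
    case False
    then show ?thesis
      using assms(2) by (simp add: cball_scale)
  qed (simp add: image_constant_conv)
  then show ?thesis
    using dvol_scaleR[OF convex_body_cball[of 1 0] assms] by (simp add: dvol_translation)
qed

lemma dvol_le_circumradius:
  fixes K :: "'a::euclidean_space set"
  assumes "convex_body K" "convex_body M" "K \<subseteq> cball c R" "R \<ge> 0"
  shows "dvol K M \<le> R * dvol (cball 0 1) M"
  using dvol_mono[OF assms(1) convex_body_cball assms(2,3)] dvol_cball[OF assms(2,4)] assms(4) by simp

lemma dvol_inequality:
  fixes K M :: "'a::euclidean_space set"
  assumes K: "convex_body K" and M: "convex_body M"
  shows "2 * unit_ball_vol (real (DIM('a) - 1)) * dvol K M \<le> dvol K (cball 0 1) * dvol (cball 0 1) M"
proof -
  let ?k = "unit_ball_vol (real (DIM('a) - 1))"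
  have "compact K" "K \<noteq> {}" using K by (auto simp: convex_body_def)
  then obtain R c T l where *: "R \<ge> 0" "K \<subseteq> cball c R" "T \<subseteq> K" "contact_points T l c R"
    by (rule circumball_exists)
  interpret contact_points T l c R by fact
  have B: "dvol (cball 0 1) M \<ge> 0"
    by (intro dvol_nonneg convex_body_cball M) simp
  have "2 * ?k * dvol K M \<le> 2 * ?k * (R * dvol (cball 0 1) M)"
    by (intro mult_left_mono dvol_le_circumradius[OF K M *(2,1)]) simp
  also have "\<dots> = 2 * R * ?k * dvol (cball 0 1) M" by simp
  also have "\<dots> \<le> dvol K (cball 0 1) * dvol (cball 0 1) M"
    using dvol_ball_ge_circumradius[OF K *(3)] B by (intro mult_right_mono)
  finally show ?thesis .
qed

subsection \<open>Strict monotonicity\<close>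

text \<open>If \<open>0\<close> lies in \<open>L\<close> but not in \<open>K\<close>, then a truncated cone \<open>C\<close> of directions pointing away from \<open>K\<close>
  satisfies: \<open>cball 0 1 + t K\<close> misses the shell \<open>C - (1 - t \<eta>) C\<close>, which \<open>cball 0 1 + t L\<close> contains.\<close>

lemma dvol_ball_strict_mono_0:
  fixes K L :: "'a::euclidean_space set"
  assumes K: "convex_body K" and L: "convex_body L" and KL: "K \<subseteq> L" and 0: "0 \<in> L" "0 \<notin> K"
  shows "dvol K (cball 0 1) < dvol L (cball 0 1)"
proof -
  let ?B = "cball 0 1 :: 'a set"
  have B: "convex_body ?B" by (rule convex_body_cball) simp
  have Kc: "convex K" "compact K" "closed K" using K by (auto simp: convex_body_def compact_imp_closed)
  obtain a b where ab: "a \<noteq> 0" "b > 0" "\<And>x. x \<in> K \<Longrightarrow> a \<bullet> x > b"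
    using separating_hyperplane_closed_0[OF Kc(1,3) 0(2)] by blast
  obtain \<rho> where \<rho>: "\<rho> > 0" "\<And>x. x \<in> K \<Longrightarrow> norm x \<le> \<rho>"
    using compact_imp_bounded[OF Kc(2)] bounded_pos by blast
  \<comment> \<open>The direction \<open>w\<close> below has norm 1/2, leaving room around it in the
    unit ball; accordingly \<open>\<beta>\<close> is half the distance from 0 to the separating
    hyperplane.\<close>
  define \<beta> where "\<beta> = b / (2 * norm a)"
  define w where "w = - (a /\<^sub>R (2 * norm a))"
  have \<beta>: "\<beta> > 0" using ab by (simp add: \<beta>_def)
  have w: "norm w = 1 / 2" using ab by (simp add: w_def)
  have wx: "w \<bullet> x \<le> - \<beta>" if "x \<in> K" for x
    using ab(1) ab(3)[OF that] by (simp add: w_def \<beta>_def divide_simps)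
  \<comment> \<open>Moving from \<open>w\<close> by less than \<open>\<delta>\<close> costs at most
    half of the margin \<open>\<beta>\<close>, and the other half covers the slope
    \<open>\<eta>\<close>; so the cone \<open>C\<close> contains a ball and has positive
    volume.\<close>
  define \<eta> where "\<eta> = min (1 / 2) (\<beta> / 2)"
  define \<delta> where "\<delta> = min (1 / 2) (\<beta> / (2 * \<rho>))"
  have \<eta>: "0 < \<eta>" "\<eta> \<le> 1 / 2" "\<eta> \<le> \<beta> / 2" using \<beta> by (auto simp: \<eta>_def)
  have \<delta>: "0 < \<delta>" "\<delta> \<le> 1 / 2" "\<delta> \<le> \<beta> / (2 * \<rho>)"
    using \<beta> \<rho> unfolding \<delta>_def by (auto intro: divide_pos_pos)
  have "\<delta> * \<rho> \<le> \<beta> / (2 * \<rho>) * \<rho>"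
    using \<delta>(3) \<rho>(1) by (intro mult_right_mono) auto
  then have \<delta>\<rho>: "\<delta> * \<rho> \<le> \<beta> / 2"
    using \<rho>(1) by simp
  define C where "C = {y. norm y \<le> 1 \<and> (\<forall>x\<in>K. y \<bullet> x \<le> - \<eta> * norm y)}"
  have C_eq: "C = ?B \<inter> (\<Inter>x\<in>K. {y. y \<bullet> x \<le> - \<eta> * norm y})"
    by (auto simp: C_def)
  have "closed (\<Inter>x\<in>K. {y. y \<bullet> x \<le> - \<eta> * norm y})"
    by (intro closed_INT ballI closed_Collect_le continuous_intros)
  then have C: "compact C"
    unfolding C_eq by (intro compact_Int_closed compact_cball)
  have ball_C: "ball w \<delta> \<subseteq> C"
  proof
    fix y assume "y \<in> ball w \<delta>"
    then have y: "norm (y - w) < \<delta>" by (simp add: dist_norm norm_minus_commute)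
    have ny: "norm y \<le> 1"
      using norm_triangle_ineq[of w "y - w"] y w \<delta> by simp
    have "y \<bullet> x \<le> - \<eta> * norm y" if x: "x \<in> K" for x
    proof -
      have "y \<bullet> x = w \<bullet> x + (y - w) \<bullet> x"
        by (simp add: inner_diff_left)
      also have "(y - w) \<bullet> x \<le> norm (y - w) * norm x"
        by (rule norm_cauchy_schwarz)
      also have "norm (y - w) * norm x \<le> \<delta> * \<rho>"
        using y \<rho>(2)[OF x] \<delta>(1) by (intro mult_mono) auto
      finally have "y \<bullet> x \<le> - (\<beta> / 2)"
        using wx[OF x] \<delta>\<rho> by simp
      moreover have "\<eta> * norm y \<le> \<beta> / 2 * 1"
        using \<eta> ny \<beta> by (intro mult_mono) auto
      ultimately show ?thesis by simp
    qed
    then show "y \<in> C" using ny by (simp add: C_def)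
  qed
  have "0 < vol (ball w \<delta>)"
    using content_ball_pos[OF \<delta>(1), of w] by simp
  also have "\<dots> \<le> vol C"
    using ball_C C by (intro measure_mono_fmeasurable) (auto simp: lmeasurable_compact)
  finally have volC: "vol C > 0" .
  have shell: "(vol (?B + (*\<^sub>R) t ` K) - vol ?B) / t + \<eta> * vol C \<le> (vol (?B + (*\<^sub>R) t ` L) - vol ?B) / t"
    if t: "0 < t" "t < 1" for t
  proof -
    define s where "s = 1 - t * \<eta>"
    have "t * \<eta> \<le> 1 * (1 / 2)" using t \<eta> by (intro mult_mono) auto
    then have s: "0 < s" "s < 1" using t \<eta> by (auto simp: s_def)
    define D where "D = C - (*\<^sub>R) s ` C"
    have sC: "(*\<^sub>R) s ` C \<subseteq> C"
    proof
      fix y assume "y \<in> (*\<^sub>R) s ` C"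
      then obtain z where z: "z \<in> C" "y = s *\<^sub>R z" by blast
      have "norm y \<le> 1 * 1"
        unfolding z(2) norm_scaleR using z(1) s by (intro mult_mono) (auto simp: C_def)
      moreover have "y \<bullet> x \<le> - \<eta> * norm y" if "x \<in> K" for x
        using z(1) that s mult_left_mono[of "z \<bullet> x" "- \<eta> * norm z" s] by (simp add: C_def z(2) mult_ac)
      ultimately show "y \<in> C" by (simp add: C_def)
    qed
    have sCc: "compact ((*\<^sub>R) s ` C)" by (intro compact_scaling C)
    have Dm: "D \<in> lmeasurable"
      unfolding D_def using C sCc by (intro fmeasurable.Diff lmeasurable_compact)
    have "vol D = vol C - vol ((*\<^sub>R) s ` C)"
      unfolding D_def using C sCc sC by (intro measurable_measure_Diff) (auto simp: lmeasurable_compact fmeasurableD)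
    also have "vol ((*\<^sub>R) s ` C) = s ^ DIM('a) * vol C"
      using s by (simp add: vol_scaleR)
    finally have "vol D = vol C - s ^ DIM('a) * vol C" .
    \<comment> \<open>This makes the volume of the shell at least proportional to \<open>t\<close>,
      so that it survives division by \<open>t\<close> in the limit.\<close>
    moreover have "s ^ DIM('a) * vol C \<le> s * vol C"
      using s volC power_decreasing[of 1 "DIM('a)" s] by (intro mult_right_mono) (auto simp: Suc_leI)
    moreover have "s * vol C = vol C - t * (\<eta> * vol C)"
      by (simp add: s_def algebra_simps)
    ultimately have volD: "vol D \<ge> t * (\<eta> * vol C)"
      by linarith
    \<comment> \<open>Pairing y = u + t z with \<open>y\<close> loses t \<eta> |y|, so |y| \<le> s,
      and the cone property puts \<open>y\<close> into the removed part.\<close>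
    have disj: "(?B + (*\<^sub>R) t ` K) \<inter> D = {}"
    proof (rule ccontr)
      assume "\<not> ?thesis"
      then obtain y where y: "y \<in> ?B + (*\<^sub>R) t ` K" "y \<in> C" "y \<notin> (*\<^sub>R) s ` C"
        by (auto simp: D_def)
      obtain u z where uz: "norm u \<le> 1" "z \<in> K" "y = u + t *\<^sub>R z"
        using y(1) by (auto elim!: set_plus_elim)
      have "norm y * norm y = y \<bullet> u + t * (y \<bullet> z)"
        using arg_cong[OF uz(3), of "\<lambda>v. y \<bullet> v"]
        by (simp add: inner_add_right power2_norm_eq_inner[symmetric] power2_eq_square)
      also have "y \<bullet> u \<le> norm y * 1"
        using norm_cauchy_schwarz[of y u] uz(1) by (meson mult_left_mono norm_ge_zero order_trans)
      also have "t * (y \<bullet> z) \<le> t * (- \<eta> * norm y)"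
        using y(2) uz(2) t by (intro mult_left_mono) (auto simp: C_def)
      finally have "norm y * norm y \<le> norm y * s"
        by (simp add: s_def algebra_simps)
      then have ny: "norm y \<le> s"
        using s by (cases "y = 0") auto
      have "(1 / s) *\<^sub>R y \<in> C"
      proof -
        have "norm ((1 / s) *\<^sub>R y) \<le> 1" using ny s by simp
        moreover have "((1 / s) *\<^sub>R y) \<bullet> x \<le> - \<eta> * norm ((1 / s) *\<^sub>R y)" if "x \<in> K" for x
          using y(2) that s divide_right_mono[of "y \<bullet> x" "- \<eta> * norm y" s] by (simp add: C_def)
        ultimately show ?thesis by (simp add: C_def)
      qed
      then have "s *\<^sub>R ((1 / s) *\<^sub>R y) \<in> (*\<^sub>R) s ` C" by (rule imageI)
      then show False using y(3) s by simp
    qed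
    have comp: "compact (?B + (*\<^sub>R) t ` K)" "compact (?B + (*\<^sub>R) t ` L)"
      using compact_plus_scaleR B K L by blast+
    have "C \<subseteq> ?B + (*\<^sub>R) t ` L"
    proof
      fix y assume "y \<in> C"
      then have "y + t *\<^sub>R 0 \<in> ?B + (*\<^sub>R) t ` L"
        using 0 by (intro set_plus_intro imageI) (auto simp: C_def)
      then show "y \<in> ?B + (*\<^sub>R) t ` L" by simp
    qed
    then have sub: "(?B + (*\<^sub>R) t ` K) \<union> D \<subseteq> ?B + (*\<^sub>R) t ` L"
      using set_plus_mono2[OF order_refl image_mono[OF KL]] by (auto simp: D_def)
    have "vol (?B + (*\<^sub>R) t ` K) + vol D = vol ((?B + (*\<^sub>R) t ` K) \<union> D)"
      using comp Dm disj by (subst measure_Un3) (auto simp: lmeasurable_compact)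
    also have "\<dots> \<le> vol (?B + (*\<^sub>R) t ` L)"
      using comp Dm sub by (intro measure_mono_fmeasurable) (auto simp: lmeasurable_compact fmeasurableD)
    finally have "vol (?B + (*\<^sub>R) t ` K) + t * (\<eta> * vol C) \<le> vol (?B + (*\<^sub>R) t ` L)"
      using volD by simp
    then have "(vol (?B + (*\<^sub>R) t ` K) + t * (\<eta> * vol C) - vol ?B) / t \<le> (vol (?B + (*\<^sub>R) t ` L) - vol ?B) / t"
      using t by (intro divide_right_mono) auto
    then show ?thesis
      using t by (simp add: add_divide_distrib diff_divide_distrib)
  qed
  have "dvol K ?B + \<eta> * vol C \<le> dvol L ?B"
  proof (rule tendsto_le[OF _ dvol_tendsto[OF L B] tendsto_add[OF dvol_tendsto[OF K B] tendsto_const]])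
    show "\<forall>\<^sub>F t in at_right 0. (vol (?B + (*\<^sub>R) t ` K) - vol ?B) / t + \<eta> * vol C \<le> (vol (?B + (*\<^sub>R) t ` L) - vol ?B) / t"
      unfolding eventually_at_right_field using shell by (intro exI[of _ 1]) auto
  qed simp
  then show ?thesis
    using mult_pos_pos[OF \<eta>(1) volC] by linarith
qed

lemma convex_body_translation: "convex_body K \<Longrightarrow> convex_body ((+) a ` (K :: 'a::euclidean_space set))"
  by (auto simp: convex_body_def compact_translation convex_translation)

lemma dvol_ball_strict_mono:
  fixes K L :: "'a::euclidean_space set"
  assumes "convex_body K" "convex_body L" "K \<subseteq> L" "K \<noteq> L"
  shows "dvol K (cball 0 1) < dvol L (cball 0 1)"
proof -
  obtain x where x: "x \<in> L" "x \<notin> K" using assms by auto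
  have "dvol ((+) (- x) ` K) (cball 0 1) < dvol ((+) (- x) ` L) (cball 0 1)"
    using assms x by (intro dvol_ball_strict_mono_0 convex_body_translation image_mono) (auto simp: image_iff)
  then show ?thesis by (simp only: dvol_translation)
qed

text \<open>\<open>T\<close> is the closure of its interior, so a closed proper subset misses an
  open piece of it.\<close>

lemma vol_strict_mono:
  fixes S T :: "'a::euclidean_space set"
  assumes "compact S" "convex_body T" "S \<subseteq> T" "S \<noteq> T" "interior T \<noteq> {}"
  shows "vol S < vol T"
proof -
  have T: "compact T" "convex T" "closed T"
    using assms(2) by (auto simp: convex_body_def compact_imp_closed)
  have "\<not> interior T \<subseteq> S"
  proof
    assume "interior T \<subseteq> S"
    then have "closure (interior T) \<subseteq> S"
      using assms(1) by (simp add: closure_minimal compact_imp_closed)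
    moreover have "closure (interior T) = T"
      using convex_closure_interior[OF T(2) assms(5)] T(3) by simp
    ultimately show False using assms(3,4) by simp
  qed
  then obtain x where x: "x \<in> interior T - S" by blast
  have "open (interior T - S)"
    using assms(1) by (simp add: compact_imp_closed open_Diff)
  then obtain e where e: "e > 0" "ball x e \<subseteq> interior T - S"
    using x open_contains_ball by blast
  have "0 < vol (ball x e)"
    using content_ball_pos[OF e(1), of x] by simp
  moreover have "vol S + vol (ball x e) = vol (S \<union> ball x e)"
  proof -
    have "S \<inter> ball x e = {}" using e by blast
    then show ?thesis
      using assms(1) by (subst measure_Un3) (auto simp: lmeasurable_compact)
  qed
  moreover have "vol (S \<union> ball x e) \<le> vol T"
    using e assms(1,3) T interior_subset[of T]
    by (intro measure_mono_fmeasurable) (auto simp: lmeasurable_compact fmeasurableD)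
  ultimately show ?thesis by linarith
qed

subsection \<open>The equality case\<close>

lemma dvol_closed_segment: "dvol (closed_segment a b) M = dvol (closed_segment 0 (b - a)) M"
proof -
  have "closed_segment a b = (+) a ` closed_segment 0 (b - a)"
    using closed_segment_translation[of a 0 "b - a"] by simp
  then show ?thesis by (simp only: dvol_translation)
qed

text \<open>Fix a contact point \<open>j\<close> and take \<open>i\<close> lowest in the direction
  \<open>u = j - c\<close>. Decomposing \<open>j - i\<close> inside the zonotope gives R^2 - \<mu> =
  4 \<theta> (1 - \<theta>) (P - Q) with P - Q \<le> R^2 - \<mu>, so \<theta> = 1/2 and both
  extremes are attained. The balance P + Q = 0 then places \<open>i\<close> opposite to
  \<open>j\<close>.\<close>

lemma (in contact_points) antipodal_contact_points:
  assumes R: "R > 0" and diff: "\<And>i j. i \<in> T \<Longrightarrow> j \<in> T \<Longrightarrow> j - i \<in> zonotope"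
  obtains i j where "i \<in> T" "j \<in> T" "j - i = 2 *\<^sub>R (j - c)"
proof -
  have TB: "T \<subseteq> cball c R"
    using radius by (auto simp: dist_norm norm_minus_commute)
  have "T \<noteq> {}" using sum_l by auto
  then obtain j where j: "j \<in> T" by blast
  define u where "u = j - c"
  have u: "norm u = R" using radius[OF j] by (simp add: u_def)
  obtain i where i: "i \<in> T" and i_min: "\<And>k. k \<in> T \<Longrightarrow> (i - c) \<bullet> u \<le> (k - c) \<bullet> u"
    using ex_min_if_finite[of "(\<lambda>k. (k - c) \<bullet> u) ` T"] finite_T \<open>T \<noteq> {}\<close>
    by (auto simp: not_less)
  define \<mu> where "\<mu> = (i - c) \<bullet> u"
  \<comment> \<open>The heights average to zero, so the lowest one is not positive.\<close>
  have "(\<Sum>k\<in>T. l k * ((k - c) \<bullet> u)) = 0"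
    using arg_cong[OF sum_contact_zero, of "\<lambda>v. v \<bullet> u"] by (simp add: inner_sum_left)
  moreover have "(\<Sum>k\<in>T. l k * ((k - c) \<bullet> u)) \<ge> (\<Sum>k\<in>T. l k * \<mu>)"
    using i_min l_pos by (intro sum_mono mult_left_mono) (auto simp: \<mu>_def less_imp_le)
  ultimately have \<mu>: "\<mu> \<le> 0"
    by (simp add: sum_distrib_right[symmetric] sum_l)
  obtain p q \<theta> where pq: "p \<in> convex hull T" "q \<in> convex hull T" "0 \<le> \<theta>" "\<theta> \<le> 1"
    "j - i = (4 * \<theta> * (1 - \<theta>)) *\<^sub>R (p - q)" "\<theta> *\<^sub>R (p - c) + (1 - \<theta>) *\<^sub>R (q - c) = 0"
    using zonotope_decompose[OF diff[OF i j]] by metis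
  define P where "P = (p - c) \<bullet> u"
  define Q where "Q = (q - c) \<bullet> u"
  have "p \<in> cball c R"
    using hull_minimal[of T "cball c R" convex] TB pq(1) by auto
  then have "norm (p - c) \<le> R" by (simp add: dist_norm norm_minus_commute)
  then have "norm (p - c) * norm u \<le> R * R"
    using u R by (intro mult_mono) auto
  then have P: "P \<le> R\<^sup>2"
    using norm_cauchy_schwarz[of "p - c" u] by (simp add: P_def power2_eq_square)
  have "T \<subseteq> {x. u \<bullet> x \<ge> \<mu> + u \<bullet> c}"
    using i_min by (auto simp: \<mu>_def inner_diff_left inner_commute[of u])
  then have "convex hull T \<subseteq> {x. u \<bullet> x \<ge> \<mu> + u \<bullet> c}"
    by (intro hull_minimal convex_halfspace_ge)
  then have Q: "\<mu> \<le> Q"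
    using pq(2) by (auto simp: Q_def inner_diff_left inner_commute[of u])
  have R2: "R\<^sup>2 > 0" using R by simp
  have "u \<bullet> u = R\<^sup>2" using u by (simp add: power2_norm_eq_inner[symmetric])
  then have "R\<^sup>2 - \<mu> = (j - i) \<bullet> u"
    by (simp add: \<mu>_def u_def inner_diff_left)
  also have "\<dots> = (4 * \<theta> * (1 - \<theta>)) * (P - Q)"
    unfolding pq(5) by (simp add: P_def Q_def inner_diff_left)
  finally have eq: "R\<^sup>2 - \<mu> = (4 * \<theta> * (1 - \<theta>)) * (P - Q)" .
  have fac: "4 * \<theta> * (1 - \<theta>) = 1 - (2 * \<theta> - 1)\<^sup>2"
    by (simp add: power2_eq_square algebra_simps)
  have "4 * \<theta> * (1 - \<theta>) \<ge> 0" using pq by simp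
  then have "(4 * \<theta> * (1 - \<theta>)) * (P - Q) \<le> (4 * \<theta> * (1 - \<theta>)) * (R\<^sup>2 - \<mu>)"
    using P Q by (intro mult_left_mono) auto
  with eq have "R\<^sup>2 - \<mu> \<le> (4 * \<theta> * (1 - \<theta>)) * (R\<^sup>2 - \<mu>)"
    by (rule ord_eq_le_trans)
  also have "\<dots> = (R\<^sup>2 - \<mu>) - (2 * \<theta> - 1)\<^sup>2 * (R\<^sup>2 - \<mu>)"
    unfolding fac by (simp add: left_diff_distrib)
  finally have "R\<^sup>2 - \<mu> \<le> (R\<^sup>2 - \<mu>) - (2 * \<theta> - 1)\<^sup>2 * (R\<^sup>2 - \<mu>)" .
  then have "(2 * \<theta> - 1)\<^sup>2 * (R\<^sup>2 - \<mu>) \<le> 0" by simp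
  then have "(2 * \<theta> - 1)\<^sup>2 \<le> 0"
    using R2 \<mu> by (simp add: mult_le_0_iff)
  then have \<theta>: "\<theta> = 1 / 2" by simp
  have "R\<^sup>2 - \<mu> = P - Q" using eq unfolding \<theta> by simp
  then have "P = R\<^sup>2" "Q = \<mu>" using P Q by auto
  moreover have "P + Q = 0"
    using arg_cong[OF pq(6), of "\<lambda>v. v \<bullet> u"] unfolding \<theta> by (simp add: P_def Q_def inner_add_left)
  ultimately have "\<mu> = - R\<^sup>2" by simp
  then have "(norm ((i - c) + u))\<^sup>2 = (norm (i - c))\<^sup>2 - R\<^sup>2"
    using u unfolding power2_norm_eq_inner
    by (simp add: \<mu>_def inner_add_left inner_add_right inner_commute \<open>u \<bullet> u = R\<^sup>2\<close>)
  then have "(i - c) + u = 0"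
    using radius[OF i] by simp
  then have "j - i = 2 *\<^sub>R (j - c)"
    by (simp add: u_def scaleR_2 algebra_simps)
  then show ?thesis using that i j by blast
qed

text \<open>Strict monotonicity is used twice: it turns the zonotope into all of K - K, so that
  differences of contact points lie in it, and then turns the diameter between antipodal contact
  points into all of \<open>K\<close>.\<close>

lemma (in contact_points) segment_of_dvol_ball_eq:
  assumes K: "convex_body K" and TK: "T \<subseteq> K" and R: "R > 0"
    and eq: "dvol K (cball 0 1) = 2 * R * unit_ball_vol (real (DIM('a) - 1))"
  obtains a b where "a \<noteq> b" "K = closed_segment a b"
proof -
  have KK: "convex_body (K + uminus ` K)"
    by (intro convex_body_plus convex_body_uminus K)
  have "dvol (K + uminus ` K) (cball 0 1) = dvol zonotope (cball 0 1)"
    using dvol_add[OF K convex_body_uminus[OF K] convex_body_cball[of 1 0]] dvol_uminus_ball[OF K] eq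
    by (simp add: dvol_zonotope)
  then have Z: "zonotope = K + uminus ` K"
    using dvol_ball_strict_mono[OF convex_body_zonotope KK zonotope_subset[OF K TK]] by force
  have diff: "j - i \<in> zonotope" if "i \<in> T" "j \<in> T" for i j
  proof -
    have "j + (- i) \<in> K + uminus ` K"
      using that TK by (intro set_plus_intro imageI) auto
    then show ?thesis by (simp add: Z)
  qed
  obtain i j where ij: "i \<in> T" "j \<in> T" "j - i = 2 *\<^sub>R (j - c)"
    using R diff by (rule antipodal_contact_points)
  have norm: "norm (j - i) = 2 * R"
    unfolding ij(3) using radius[OF ij(2)] by simp
  have sub: "closed_segment i j \<subseteq> K"
    using ij TK K by (intro closed_segment_subset) (auto simp: convex_body_def)
  have "dvol (closed_segment i j) (cball 0 1) = dvol K (cball 0 1)"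
    by (simp add: dvol_closed_segment[of i] dvol_segment_ball norm eq)
  then have "closed_segment i j = K"
    using dvol_ball_strict_mono[OF convex_body_segment K sub] less_irrefl by metis
  moreover have "i \<noteq> j" using norm R by auto
  ultimately show ?thesis using that by blast
qed

text \<open>The sum of \<open>M\<close> and [0, u] is strictly larger than \<open>M\<close> but has
  the same volume, so it has empty interior. A direction \<open>u\<close> leaving the hyperplane
  would raise its affine dimension to the full one.\<close>

lemma segment_direction_in_hyperplane:
  fixes M :: "'a::euclidean_space set"
  assumes M: "convex_body M" and dim: "aff_dim M \<ge> int DIM('a) - 1" and u: "u \<noteq> 0"
    and vol: "vol (M + closed_segment 0 u) = vol M"
  shows "interior M = {}" and "M \<subseteq> {x. v \<bullet> x = k} \<Longrightarrow> v \<bullet> u = 0"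
proof -
  define S where "S = M + closed_segment 0 u"
  have S: "convex_body S"
    unfolding S_def by (intro convex_body_plus M convex_body_segment)
  have Mc: "compact M" "M \<noteq> {}" using M by (auto simp: convex_body_def)
  have MS: "x \<in> S" "x + u \<in> S" if "x \<in> M" for x
    unfolding S_def using set_plus_intro[OF that, of 0 "closed_segment 0 u"] set_plus_intro[OF that, of u "closed_segment 0 u"]
    by simp_all
  \<comment> \<open>Translating a maximiser of the functional \<open>u\<close> by \<open>u\<close>
    leaves \<open>M\<close>, which shows that the sum is strictly larger.\<close>
  obtain x where x: "x \<in> M" "\<And>y. y \<in> M \<Longrightarrow> u \<bullet> y \<le> u \<bullet> x"
    using continuous_attains_sup[OF Mc, of "\<lambda>y. u \<bullet> y"] continuous_on_inner[OF continuous_on_const continuous_on_id]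
    by blast
  have "u \<bullet> x < u \<bullet> (x + u)"
    using u by (simp add: inner_add_right)
  then have "x + u \<notin> M"
    using x(2)[of "x + u"] by linarith
  then have "M \<noteq> S" "M \<subseteq> S" using MS x(1) by auto
  then have int: "interior S = {}"
    using vol_strict_mono[OF Mc(1) S] vol by (auto simp: S_def)
  then show "interior M = {}"
    using interior_mono[OF \<open>M \<subseteq> S\<close>] by auto
  show "v \<bullet> u = 0" if hyp: "M \<subseteq> {x. v \<bullet> x = k}"
  proof (rule ccontr)
    assume "v \<bullet> u \<noteq> 0"
    have aff: "affine hull M \<subseteq> {x. v \<bullet> x = k}"
      using hyp by (intro hull_minimal affine_hyperplane)
    have "v \<bullet> x = k" using hyp x(1) by blast
    then have "v \<bullet> (x + u) \<noteq> k"
      using \<open>v \<bullet> u \<noteq> 0\<close> by (simp add: inner_add_right)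
    then have "x + u \<notin> affine hull M"
      using aff by blast
    then have "aff_dim (insert (x + u) M) \<ge> int DIM('a)"
      using dim by (simp add: aff_dim_insert)
    moreover have "aff_dim (insert (x + u) M) \<le> aff_dim S"
      using MS x(1) by (intro aff_dim_subset) auto
    ultimately have "aff_dim S = int DIM('a)"
      using aff_dim_le_DIM[of S] by linarith
    then have "interior S = rel_interior S"
      by (simp add: interior_rel_interior)
    then show False
      using int S rel_interior_eq_empty[of S] by (auto simp: convex_body_def)
  qed
qed

lemma vol_plus_segment_eq:
  assumes "convex_body M" "dvol (closed_segment 0 u) M = 0"
  shows "vol (M + closed_segment 0 u) = vol M"
  using dvol_segment[OF assms(1), of u] assms(2) by simp

text \<open>One direction orthogonal to \<open>e\<close>, available in dimension at least 2,
  flattens \<open>M\<close> into some hyperplane with normal \<open>v\<close>. The part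
  \<open>w\<close> of \<open>v\<close> orthogonal to \<open>e\<close> is again an admissible
  direction, hence orthogonal to \<open>v\<close> and so zero.\<close>

lemma contained_in_hyperplane:
  fixes M :: "'a::euclidean_space set"
  assumes M: "convex_body M" and dim: "aff_dim M \<ge> int DIM('a) - 1" and n: "DIM('a) \<ge> 2" and e: "e \<noteq> 0"
    and dvol: "\<And>u. u \<bullet> e = 0 \<Longrightarrow> dvol (closed_segment 0 u) M = 0"
  shows "\<exists>k. \<forall>x\<in>M. e \<bullet> x = k"
proof -
  obtain u where u: "u \<noteq> 0" "u \<bullet> e = 0"
    using orthogonal_to_vector_exists[OF n, of e] by (auto simp: orthogonal_def inner_commute)
  have "interior M = {}"
    using segment_direction_in_hyperplane(1)[OF M dim u(1)] vol_plus_segment_eq[OF M dvol[OF u(2)]] by simp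
  then obtain v k where v: "v \<noteq> 0" "M \<subseteq> {x. v \<bullet> x = k}"
    using empty_interior_subset_hyperplane[of M] M by (auto simp: convex_body_def)
  define r where "r = (v \<bullet> e) / (e \<bullet> e)"
  define w where "w = v - r *\<^sub>R e"
  have we: "w \<bullet> e = 0"
    using e by (simp add: w_def r_def inner_diff_left)
  have "w = 0"
  proof (rule ccontr)
    assume "w \<noteq> 0"
    then have "v \<bullet> w = 0"
      using segment_direction_in_hyperplane(2)[OF M dim _ vol_plus_segment_eq[OF M dvol[OF we]] v(2)] by simp
    then have "w \<bullet> w = 0"
      using we by (simp add: w_def inner_diff_left inner_commute)
    then show False using \<open>w \<noteq> 0\<close> by simp
  qed
  then have "v = r *\<^sub>R e" by (simp add: w_def)
  then have "r \<noteq> 0" "\<forall>x\<in>M. r * (e \<bullet> x) = k"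
    using v by auto
  then have "\<forall>x\<in>M. e \<bullet> x = k / r"
    by (simp add: field_simps)
  then show ?thesis by blast
qed

lemma dvol_segment_le:
  fixes M :: "'a::euclidean_space set"
  assumes "convex_body M"
  shows "dvol (closed_segment 0 u) M \<le> norm u * dvol (cball 0 1) M"
  by (rule dvol_le_circumradius[OF convex_body_segment assms, of _ _ 0])
    (auto simp: in_segment mult_left_le_one_le)

text \<open>Otherwise every segment has derivative zero, so \<open>M\<close> lies in a hyperplane
  parallel to its own normal. Positivity allows D(B, M) to be cancelled in the equality
  case.\<close>

lemma dvol_ball_pos:
  fixes M :: "'a::euclidean_space set"
  assumes M: "convex_body M" and dim: "aff_dim M \<ge> int DIM('a) - 1"
  shows "dvol (cball 0 1) M > 0"
proof (rule ccontr)
  assume "\<not> ?thesis"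
  then have "dvol (cball 0 1) M = 0"
    using dvol_nonneg[OF convex_body_cball[of 1 0] M] by simp
  then have dvol: "dvol (closed_segment 0 u) M = 0" for u
    using dvol_segment_le[OF M, of u] dvol_nonneg[OF convex_body_segment[of 0 u] M] by simp
  obtain b :: 'a where b: "b \<in> Basis" using nonempty_Basis by blast
  then have "interior M = {}"
    using segment_direction_in_hyperplane(1)[OF M dim nonzero_Basis vol_plus_segment_eq[OF M dvol]] by simp
  then obtain v k where v: "v \<noteq> 0" "M \<subseteq> {x. v \<bullet> x = k}"
    using empty_interior_subset_hyperplane[of M] M by (auto simp: convex_body_def)
  then have "v \<bullet> v = 0"
    using segment_direction_in_hyperplane(2)[OF M dim v(1) vol_plus_segment_eq[OF M dvol] v(2)] by simp
  then show False using v by simp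
qed

text \<open>The ball contains the rectangles with sides \<open>2 a e\<close> and \<open>2 b u\<close>, \<open>a\<^sup>2 + b\<^sup>2 = 1\<close>;
  as \<open>b \<rightarrow> 0\<close> the loss \<open>1 - a\<close> in the direction \<open>e\<close> is of second order in \<open>b\<close>.\<close>

lemma dvol_orthogonal_segment_zero:
  fixes M :: "'a::euclidean_space set"
  assumes M: "convex_body M" and e: "norm e = 1" and eq: "2 * dvol (closed_segment 0 e) M = dvol (cball 0 1) M"
    and ue: "u \<bullet> e = 0"
  shows "dvol (closed_segment 0 u) M = 0"
proof -
  let ?d = "\<lambda>u. dvol (closed_segment 0 u) M"
  have dn: "?d v \<ge> 0" for v by (intro dvol_nonneg convex_body_segment M)
  have unit: "?d v = 0" if v: "norm v = 1" "v \<bullet> e = 0" for v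
  proof -
    have bound: "?d v \<le> s * ?d e" if s: "0 < s" "s < 1" for s
    proof -
      \<comment> \<open>Rational parametrisation of the unit circle: \<open>b\<close> is of order s
        and \<open>1 - a\<close> of order s^2.\<close>
      define a where "a = (1 - s\<^sup>2) / (1 + s\<^sup>2)"
      define b where "b = 2 * s / (1 + s\<^sup>2)"
      have s2: "1 + s\<^sup>2 > 0" "s\<^sup>2 < 1" using s by (auto simp: add_pos_nonneg power_less_one_iff)
      have ab: "a \<ge> 0" "b \<ge> 0" using s s2 by (auto simp: a_def b_def)
      have "(1 - s\<^sup>2)\<^sup>2 + (2 * s)\<^sup>2 = (1 + s\<^sup>2)\<^sup>2"
        by (simp add: power2_eq_square algebra_simps)
      then have ab2: "a\<^sup>2 + b\<^sup>2 = 1"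
        using s2 by (simp add: a_def b_def power_divide add_divide_distrib[symmetric])
      define S where "S = closed_segment 0 ((2 * a) *\<^sub>R e) + closed_segment 0 ((2 * b) *\<^sub>R v)"
      have "S \<subseteq> cball (a *\<^sub>R e + b *\<^sub>R v) 1"
      proof
        fix x assume "x \<in> S"
        then obtain p q where pq: "0 \<le> p" "p \<le> 1" "0 \<le> q" "q \<le> 1" "x = (p * (2 * a)) *\<^sub>R e + (q * (2 * b)) *\<^sub>R v"
          unfolding S_def by (auto elim!: set_plus_elim simp: in_segment)
        have x_eq: "x - (a *\<^sub>R e + b *\<^sub>R v) = (a * (2 * p - 1)) *\<^sub>R e + (b * (2 * q - 1)) *\<^sub>R v"
          by (simp add: pq(5) algebra_simps)
        have ee: "e \<bullet> e = 1" "v \<bullet> v = 1" "e \<bullet> v = 0"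
          using e v by (simp_all add: power2_norm_eq_inner[symmetric] inner_commute)
        have "(norm (x - (a *\<^sub>R e + b *\<^sub>R v)))\<^sup>2 = (a * (2 * p - 1))\<^sup>2 + (b * (2 * q - 1))\<^sup>2"
          unfolding x_eq power2_norm_eq_inner
          by (simp add: inner_add_left inner_add_right ee v(2) power2_eq_square)
        also have "\<dots> = a\<^sup>2 * (2 * p - 1)\<^sup>2 + b\<^sup>2 * (2 * q - 1)\<^sup>2"
          by (simp add: power_mult_distrib)
        also have "\<dots> \<le> a\<^sup>2 * 1 + b\<^sup>2 * 1"
          using pq by (intro add_mono mult_left_mono) (auto simp: abs_square_le_1)
        finally have "(norm (x - (a *\<^sub>R e + b *\<^sub>R v)))\<^sup>2 \<le> 1\<^sup>2"
          using ab2 by simp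
        then have "norm (x - (a *\<^sub>R e + b *\<^sub>R v)) \<le> 1"
          by (rule power2_le_imp_le) simp
        then show "x \<in> cball (a *\<^sub>R e + b *\<^sub>R v) 1"
          by (simp add: dist_norm norm_minus_commute)
      qed
      then have "dvol S M \<le> 1 * dvol (cball 0 1) M"
        unfolding S_def by (intro dvol_le_circumradius convex_body_plus convex_body_segment M) auto
      moreover have "dvol S M = 2 * a * ?d e + 2 * b * ?d v"
        unfolding S_def using ab
        by (simp add: dvol_add convex_body_segment M dvol_scaleR_segment)
      ultimately have "2 * a * ?d e + 2 * b * ?d v \<le> 2 * ?d e"
        using eq by linarith
      then have "b * ?d v \<le> (1 - a) * ?d e"
        by (simp add: algebra_simps)
      then have "((1 + s\<^sup>2) * b) * ?d v \<le> ((1 + s\<^sup>2) * (1 - a)) * ?d e"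
        using s2 by (simp add: mult.assoc)
      moreover have "(1 + s\<^sup>2) * b = 2 * s"
        using s2 by (simp add: b_def)
      moreover have "(1 + s\<^sup>2) * (1 - a) = 2 * s * s"
      proof -
        have "(1 + s\<^sup>2) * a = 1 - s\<^sup>2"
          using s2 by (simp add: a_def)
        then show ?thesis
          by (simp add: right_diff_distrib power2_eq_square)
      qed
      ultimately show ?thesis
        using s by (simp add: mult.assoc)
    qed
    show ?thesis
    proof (rule ccontr)
      assume "?d v \<noteq> 0"
      then have pos: "?d v > 0" using dn[of v] by simp
      \<comment> \<open>Makes \<open>s * ?d e\<close> at most half of \<open>?d v\<close>; the added
        1 guards against \<open>?d e = 0\<close>.\<close>
      define s where "s = min (1 / 2) (?d v / (2 * (?d e + 1)))"
      have s: "0 < s" "s < 1" using pos dn[of e] by (auto simp: s_def)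
      have "s * ?d e \<le> (?d v / (2 * (?d e + 1))) * (?d e + 1)"
        using s dn[of e] by (intro mult_mono) (auto simp: s_def intro!: divide_nonneg_nonneg dn)
      also have "\<dots> = ?d v / 2" using dn[of e] by (simp add: field_simps)
      finally show False using bound[OF s] pos by simp
    qed
  qed
  show ?thesis
  proof (cases "u = 0")
    case True
    then show ?thesis by (simp add: dvol_singleton M)
  next
    case False
    then have "?d (u /\<^sub>R norm u) = 0" using ue by (intro unit) auto
    then show ?thesis
      using dvol_scaleR_segment[OF M, of "norm u" "u /\<^sub>R norm u"] False by simp
  qed
qed

text \<open>The ball lies in the sum of the unit disc orthogonal to \<open>e\<close> and [-e, e].
  The disc contributes nothing, since adding it keeps \<open>M\<close> in its hyperplane, and the
  segment has length 2.\<close>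

lemma dvol_ball_le_of_hyperplane:
  fixes M :: "'a::euclidean_space set"
  assumes M: "convex_body M" and e: "norm e = 1" and hyp: "\<And>x. x \<in> M \<Longrightarrow> e \<bullet> x = k"
  shows "dvol (cball 0 1) M \<le> 2 * dvol (closed_segment 0 e) M"
proof -
  define D where "D = cball 0 1 \<inter> {x. e \<bullet> x = 0}"
  have "compact D" "convex D" "0 \<in> D"
    unfolding D_def by (auto intro!: compact_Int_closed closed_hyperplane convex_Int convex_hyperplane)
  then have D: "convex_body D"
    by (auto simp: convex_body_def)
  have "vol (M + (*\<^sub>R) t ` D) = 0" for t
  proof (rule negligible_imp_measure0, rule negligible_subset)
    show "negligible {x. e \<bullet> x = k}"
      using e by (intro negligible_hyperplane) auto
    show "M + (*\<^sub>R) t ` D \<subseteq> {x. e \<bullet> x = k}"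
      by (auto elim!: set_plus_elim simp: inner_add_right hyp D_def)
  qed
  then have "dvol D M = 0"
    by (simp add: dvol_def vol_poly_def)
  moreover have "cball 0 1 \<subseteq> D + closed_segment (- e) e"
  proof
    fix x :: 'a assume x: "x \<in> cball 0 1"
    have ee: "e \<bullet> e = 1" using e by (simp add: power2_norm_eq_inner[symmetric])
    have "(norm (x - (e \<bullet> x) *\<^sub>R e))\<^sup>2 \<le> (norm x)\<^sup>2"
      unfolding power2_norm_eq_inner
      by (simp add: inner_diff_left inner_diff_right inner_commute ee)
    then have "norm (x - (e \<bullet> x) *\<^sub>R e) \<le> norm x"
      by (rule power2_le_imp_le) simp
    then have "x - (e \<bullet> x) *\<^sub>R e \<in> D"
      using x by (simp add: D_def inner_diff_right ee)
    moreover have "(e \<bullet> x) *\<^sub>R e \<in> closed_segment (- e) e"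
    proof -
      have "\<bar>e \<bullet> x\<bar> \<le> 1"
        using Cauchy_Schwarz_ineq2[of e x] e x by simp
      moreover have "(e \<bullet> x) *\<^sub>R e = (1 - (1 + e \<bullet> x) / 2) *\<^sub>R (- e) + ((1 + e \<bullet> x) / 2) *\<^sub>R e"
        by (simp add: scaleR_left_distrib[symmetric] scaleR_minus_left[symmetric] field_simps del: scaleR_minus_left)
      ultimately show ?thesis
        unfolding in_segment by (intro exI[of _ "(1 + e \<bullet> x) / 2"]) (auto simp: abs_le_iff)
    qed
    ultimately have "(x - (e \<bullet> x) *\<^sub>R e) + (e \<bullet> x) *\<^sub>R e \<in> D + closed_segment (- e) e"
      by (rule set_plus_intro)
    then show "x \<in> D + closed_segment (- e) e" by simp
  qed
  then have "dvol (cball 0 1) M \<le> dvol (D + closed_segment (- e) e) M"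
    by (intro dvol_mono convex_body_cball convex_body_plus D convex_body_segment M) auto
  moreover have "dvol (D + closed_segment (- e) e) M = dvol D M + 2 * dvol (closed_segment 0 e) M"
    using dvol_scaleR_segment[OF M, of 2 e]
    by (simp add: dvol_add D convex_body_segment M dvol_closed_segment[of "- e"] scaleR_2)
  ultimately show ?thesis by simp
qed

text \<open>Equality squeezes both links of the chain through the circumradius. The dimension
  hypotheses give R > 0 and D(B, M) > 0, so each link becomes an equality that can be analysed on
  its own.\<close>

lemma dvol_equality_iff:
  fixes K M :: "'a::euclidean_space set"
  assumes n: "DIM('a) \<ge> 2" and K: "convex_body K" and M: "convex_body M"
    and dimK: "aff_dim K \<ge> 1" and dimM: "aff_dim M \<ge> int DIM('a) - 1"
  shows "2 * unit_ball_vol (real (DIM('a) - 1)) * dvol K M = dvol K (cball 0 1) * dvol (cball 0 1) M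
    \<longleftrightarrow> (\<exists>a b. a \<noteq> b \<and> K = closed_segment a b \<and> (\<exists>c. \<forall>x\<in>M. (b - a) \<bullet> x = c))"
    (is "?eq \<longleftrightarrow> ?geo")
proof
  let ?k = "unit_ball_vol (real (DIM('a) - 1))"
  have k: "?k > 0" by simp
  assume eq: ?eq
  have "compact K" "K \<noteq> {}" using K by (auto simp: convex_body_def)
  then obtain R c T l where *: "R \<ge> 0" "K \<subseteq> cball c R" "T \<subseteq> K" "contact_points T l c R"
    by (rule circumball_exists)
  interpret contact_points T l c R by fact
  have R: "R > 0"
  proof (rule ccontr)
    assume "\<not> R > 0"
    then have "K \<subseteq> {c}" using * by auto
    then have "aff_dim K \<le> aff_dim {c}" by (rule aff_dim_subset)
    then show False using dimK by simp
  qed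
  have B: "dvol (cball 0 1) M > 0" by (rule dvol_ball_pos[OF M dimM])
  have 1: "2 * ?k * dvol K M \<le> 2 * ?k * (R * dvol (cball 0 1) M)"
    by (intro mult_left_mono dvol_le_circumradius[OF K M *(2,1)]) simp
  have 2: "2 * R * ?k * dvol (cball 0 1) M \<le> dvol K (cball 0 1) * dvol (cball 0 1) M"
    using dvol_ball_ge_circumradius[OF K *(3)] B by (intro mult_right_mono) auto
  have "dvol K (cball 0 1) * dvol (cball 0 1) M = 2 * R * ?k * dvol (cball 0 1) M"
  proof -
    have "2 * ?k * (R * dvol (cball 0 1) M) = 2 * R * ?k * dvol (cball 0 1) M" by simp
    then show ?thesis using 1 2 eq by linarith
  qed
  then have eqK: "dvol K (cball 0 1) = 2 * R * ?k" using B by simp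
  then have eqM: "dvol K M = R * dvol (cball 0 1) M"
  proof -
    have "2 * ?k * dvol K M = 2 * ?k * (R * dvol (cball 0 1) M)"
      using eq unfolding eqK by simp
    then show ?thesis
      unfolding mult_cancel_left using k by linarith
  qed
  obtain a b where ab: "a \<noteq> b" "K = closed_segment a b"
    using segment_of_dvol_ball_eq[OF K *(3) R eqK] by blast
  define e where "e = (b - a) /\<^sub>R norm (b - a)"
  have e: "norm e = 1" "e \<noteq> 0" "b - a = norm (b - a) *\<^sub>R e" using ab(1) by (auto simp: e_def)
  have "norm (b - a) * ?k = 2 * R * ?k"
    using eqK by (simp add: ab(2) dvol_closed_segment[of a] dvol_segment_ball)
  \<comment> \<open>The segment is a diameter of the circumscribed ball, which yields the
    normalisation required by \<open>dvol_orthogonal_segment_zero\<close>.\<close>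
  then have nab: "norm (b - a) = 2 * R"
    unfolding mult_cancel_right using k by linarith
  have "dvol K M = norm (b - a) * dvol (closed_segment 0 e) M"
    using dvol_scaleR_segment[OF M, of "norm (b - a)" e] e(3) by (simp add: ab(2) dvol_closed_segment[of a])
  then have "2 * dvol (closed_segment 0 e) M = dvol (cball 0 1) M"
    using eqM nab R by simp
  then have "\<exists>k. \<forall>x\<in>M. e \<bullet> x = k"
    using dvol_orthogonal_segment_zero[OF M e(1)] by (intro contained_in_hyperplane[OF M dimM n e(2)]) blast
  then obtain k where "\<forall>x\<in>M. e \<bullet> x = k" by blast
  then have "\<forall>x\<in>M. (b - a) \<bullet> x = norm (b - a) * k"
    by (subst e(3)) simp
  then show ?geo using ab by blast
next
  let ?k = "unit_ball_vol (real (DIM('a) - 1))"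
  assume ?geo
  then obtain a b c where ab: "a \<noteq> b" "K = closed_segment a b" "\<And>x. x \<in> M \<Longrightarrow> (b - a) \<bullet> x = c"
    by blast
  define e where "e = (b - a) /\<^sub>R norm (b - a)"
  have e: "norm e = 1" "b - a = norm (b - a) *\<^sub>R e" using ab(1) by (auto simp: e_def)
  have "e \<bullet> x = c / norm (b - a)" if "x \<in> M" for x
    using ab(3)[OF that] by (simp add: e_def divide_inverse mult.commute)
  then have le: "dvol (cball 0 1) M \<le> 2 * dvol (closed_segment 0 e) M"
    using M e(1) by (intro dvol_ball_le_of_hyperplane)
  have "dvol K M = norm (b - a) * dvol (closed_segment 0 e) M"
    using dvol_scaleR_segment[OF M, of "norm (b - a)" e] e(2) by (simp add: ab(2) dvol_closed_segment[of a])
  moreover have "dvol K (cball 0 1) = norm (b - a) * ?k"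
    by (simp add: ab(2) dvol_closed_segment[of a] dvol_segment_ball)
  moreover have "(norm (b - a) * ?k) * dvol (cball 0 1) M \<le> (norm (b - a) * ?k) * (2 * dvol (closed_segment 0 e) M)"
    using le by (intro mult_left_mono) auto
  \<comment> \<open>One direction is the general inequality, the other is the bound
    \<open>le\<close> for a body in an orthogonal hyperplane.\<close>
  ultimately show ?eq
    using dvol_inequality[OF K M] by (simp add: mult_ac)
qed

section \<open>Translation back to mixed and intrinsic volumes\<close>

lemma mixed_vol_1: "convex_body K \<Longrightarrow> convex_body M \<Longrightarrow> mixed_vol K M 1 = dvol K M / real DIM('a)"
  for K M :: "'a::euclidean_space set"
  using mixed_vol_eq_coeff[of K M 1] DIM_positive[where 'a='a] by (simp add: dvol_def Suc_leI)

lemma intrinsic_vol_1: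
  fixes K :: "'a::euclidean_space set"
  assumes "convex_body K"
  shows "intrinsic_vol K 1 = dvol K (cball 0 1) / unit_ball_vol (real (DIM('a) - 1))"
  using mixed_vol_1[OF assms convex_body_cball[of 1 0]] DIM_positive[where 'a='a]
  by (simp add: intrinsic_vol_def)

text \<open>Reversal of coefficients makes this a first-order quantity; the 2 is the length of the
  unit ball of the line.\<close>

lemma intrinsic_vol_codim_1:
  fixes M :: "'a::euclidean_space set"
  assumes M: "convex_body M"
  shows "intrinsic_vol M (DIM('a) - 1) = dvol (cball 0 1) M / 2"
proof -
  let ?n = "DIM('a)"
  have B: "convex_body (cball 0 1 :: 'a set)" by (simp add: convex_body_cball)
  have n: "?n \<ge> 1" using DIM_positive[where 'a='a] by (simp add: Suc_leI)
  have "real (?n choose (?n - 1)) \<noteq> 0" by simp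
  then show ?thesis
    using mixed_vol_eq_coeff[OF M B, of "?n - 1"] coeff_vol_poly_swap[OF M B n] n
    by (simp add: intrinsic_vol_def dvol_def)
qed

theorem theorem1p2:
  fixes K M :: "'a::euclidean_space set"
  assumes "DIM('a) \<ge> 2"
    and "convex_body K" and "convex_body M"
  shows "mixed_vol K M 1 \<le> intrinsic_vol K 1 * intrinsic_vol M (DIM('a) - 1) / real DIM('a) \<and>
         (aff_dim K \<ge> 1 \<longrightarrow> aff_dim M \<ge> int DIM('a) - 1 \<longrightarrow>
         (mixed_vol K M 1 = intrinsic_vol K 1 * intrinsic_vol M (DIM('a) - 1) / real DIM('a)
          \<longleftrightarrow> (\<exists>a b. a \<noteq> b \<and> K = closed_segment a b \<and>
                  (\<exists>c. \<forall>x\<in>M. (b - a) \<bullet> x = c))))"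
proof -
  let ?k = "unit_ball_vol (real (DIM('a) - 1))"
  let ?B = "cball 0 1 :: 'a set"
  have k: "?k > 0" and n: "real DIM('a) > 0" by simp_all
  have rhs: "intrinsic_vol K 1 * intrinsic_vol M (DIM('a) - 1) / real DIM('a)
      = (dvol K ?B * dvol ?B M / (2 * ?k)) / real DIM('a)"
    unfolding intrinsic_vol_1[OF assms(2)] intrinsic_vol_codim_1[OF assms(3)] by simp
  have lhs: "mixed_vol K M 1 = dvol K M / real DIM('a)"
    using assms by (intro mixed_vol_1)
  have le: "x / m \<le> (y / (2 * \<kappa>)) / m \<longleftrightarrow> 2 * \<kappa> * x \<le> y"
    and eq: "x / m = (y / (2 * \<kappa>)) / m \<longleftrightarrow> 2 * \<kappa> * x = y" if "\<kappa> > 0" "m > 0" for x y m \<kappa> :: real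
    using that by (auto simp: divide_le_cancel le_divide_eq eq_divide_eq mult_ac)
  show ?thesis
    unfolding lhs rhs le[OF k n] eq[OF k n]
    using dvol_inequality[OF assms(2,3)] dvol_equality_iff[OF assms] by blast
qed

end
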